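(* The canonical homomorphism $\Psi_{\mathbb{P}}:\pi_1(\mathbb{P},b_0)\rightarrow \check{\pi}_1(\mathbb{P},b_0)$ from the fundamental group of the Hawaiian Pants $\mathbb{P}$ to its first Čech homotopy group is not injective.
   Context: The Hawaiian Pants $\mathbb{P}$: For $n\in\mathbb{N}=\{1,2,\dots\}$ let $C_n\subseteq \mathbb{R}^2$ be the circle of radius $\frac{1}{n}$ centered at $(\frac{1}{n},0)$, and let $\mathbb{H}=\bigcup_{i=1}^\infty C_i\subseteq\mathbb{R}^2$ (subspace topology) be the Hawaiian Earring, with basepoint $b_0=(0,0)$. Define $\ell_n:[0,1]\rightarrow C_n$ by $\ell_n(t)=(\frac{1}{n}(1-\cos 2\pi t),\frac{1}{n}\sin 2\pi t)$. For each $n$, let $D_{n,1},D_{n,2}$ be disjoint closed disks in the interior $D_n^\circ$ of a closed disk $D_n\subseteq\mathbb{R}^2$ and let $P_n=D_n\setminus(D_{n,1}^\circ\cup D_{n,2}^\circ)$ (a "pair of pants"). Let $\alpha_n,\beta_n,\gamma_n:[0,1]\rightarrow P_n$ be parametrizations (as simple closed curves) of the boundaries $\partial D_n,\partial D_{n,1},\partial D_{n,2}$, respectively, with clockwise orientation. Let $f_n:\partial P_n\rightarrow\mathbb{H}$ be the map with $f_n\circ\alpha_n=\ell_n$, $f_n\circ\beta_n=\ell_{2n}$, $f_n\circ\gamma_n=\ell_{2n+1}$, and let $f:\coprod_n\partial P_n\rightarrow\mathbb{H}$ be given by $f|_{\partial P_n}=f_n$. Then $\mathbb{P}=\mathbb{H}\cup_f\left(\coprod_{n\in\mathbb{N}}P_n\right)$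 is the adjunction space (quotient topology). First Čech homotopy group (first shape group), in its standard definition: for a pointed space $(X,x_0)$, consider pairs $(\mathcal{U},U_0)$ where $\mathcal{U}$ is an open cover of $X$, $x_0\in U_0\in\mathcal{U}$, and $\mathcal{U}$ admits a subordinated locally finite partition of unity $\{\phi_U\}_{U\in\mathcal{U}}$ with $\phi_{U_0}(x_0)=1$. These pairs are directed by (pointed) refinement; a refinement induces a simplicial map of nerves, unique up to pointed homotopy. Then $\check{\pi}_1(X,x_0)=\varprojlim \pi_1(|N(\mathcal{U})|,U_0)$, where $|N(\mathcal{U})|$ is the geometric realization of the nerve of $\mathcal{U}$. The partitions of unity define maps $X\rightarrow|N(\mathcal{U})|$ (unique up to pointed homotopy), whose induced homomorphisms on $\pi_1$ determine the canonical homomorphism $\Psi_X:\pi_1(X,x_0)\rightarrow\check{\pi}_1(X,x_0)$. *)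

theory Defs
  imports "HOL-Complex_Analysis.Complex_Analysis" "HOL-Algebra.Group"
begin

section \<open>Fundamental groups of abstract topological spaces\<close>

text \<open>The path operations of \<open>HOL-Analysis\<close> are confined to type-class topologies; here loops live
  in an arbitrary space \<open>X :: 'a topology\<close>.\<close>

definition loop_in :: "'a topology \<Rightarrow> 'a \<Rightarrow> (real \<Rightarrow> 'a) \<Rightarrow> bool" where
  "loop_in X x0 p \<longleftrightarrow> pathin X p \<and> p 0 = x0 \<and> p 1 = x0"

definition loop_homotopic :: "'a topology \<Rightarrow> 'a \<Rightarrow> (real \<Rightarrow> 'a) \<Rightarrow> (real \<Rightarrow> 'a) \<Rightarrow> bool" where
  "loop_homotopic X x0 =
     homotopic_with (\<lambda>p. p 0 = x0 \<and> p 1 = x0) (top_of_set {0..1::real}) X"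

definition loop_class :: "'a topology \<Rightarrow> 'a \<Rightarrow> (real \<Rightarrow> 'a) \<Rightarrow> (real \<Rightarrow> 'a) set" where
  "loop_class X x0 p = {q. loop_homotopic X x0 p q}"

definition loop_concat :: "(real \<Rightarrow> 'a) \<Rightarrow> (real \<Rightarrow> 'a) \<Rightarrow> real \<Rightarrow> 'a" where
  "loop_concat p q = (\<lambda>t. if t \<le> 1/2 then p (2 * t) else q (2 * t - 1))"

definition fundamental_group :: "'a topology \<Rightarrow> 'a \<Rightarrow> (real \<Rightarrow> 'a) set monoid" where
  "fundamental_group X x0 =
     \<lparr>carrier = loop_class X x0 ` Collect (loop_in X x0),
      monoid.mult = (\<lambda>A B. \<Union>p\<in>A. \<Union>q\<in>B. loop_class X x0 (loop_concat p q)),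
      one = loop_class X x0 (\<lambda>_. x0)\<rparr>"

text \<open>The map \<open>[p] \<mapsto> [h \<circ> p]\<close> into the loop classes of the pointed space \<open>(Y, y0)\<close>.\<close>

definition induced_hom ::
  "'b topology \<Rightarrow> 'b \<Rightarrow> ('a \<Rightarrow> 'b) \<Rightarrow> (real \<Rightarrow> 'a) set \<Rightarrow> (real \<Rightarrow> 'b) set" where
  "induced_hom Y y0 h A = (\<Union>p\<in>A. loop_class Y y0 (h \<circ> p))"

section \<open>Nerves and geometric realization\<close>

definition nerve :: "'a set set \<Rightarrow> 'a set set set" where
  "nerve \<U> = {\<sigma>. \<sigma> \<subseteq> \<U> \<and> finite \<sigma> \<and> \<sigma> \<noteq> {} \<and> \<Inter>\<sigma> \<noteq> {}}"

text \<open>Points of the realization are given by their barycentric coordinates.\<close>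

definition simplex_points :: "'v set \<Rightarrow> ('v \<Rightarrow> real) set" where
  "simplex_points \<sigma> = {t. (\<forall>v. 0 \<le> t v) \<and> {v. t v \<noteq> 0} \<subseteq> \<sigma> \<and> (\<Sum>v\<in>\<sigma>. t v) = 1}"

text \<open>The weak topology. Each (finite) simplex carries the subspace topology of the product topology
  on \<open>'v \<Rightarrow> real\<close>, which is its Euclidean topology.\<close>

definition realization :: "'v set set \<Rightarrow> ('v \<Rightarrow> real) topology" where
  "realization K = topology (\<lambda>W. W \<subseteq> (\<Union>\<sigma>\<in>K. simplex_points \<sigma>) \<and>
     (\<forall>\<sigma>\<in>K. openin (top_of_set (simplex_points \<sigma>)) (W \<inter> simplex_points \<sigma>)))"

lemma openin_realization:
  "openin (realization K) W \<longleftrightarrow> W \<subseteq> (\<Union>\<sigma>\<in>K. simplex_points \<sigma>) \<and>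
     (\<forall>\<sigma>\<in>K. openin (top_of_set (simplex_points \<sigma>)) (W \<inter> simplex_points \<sigma>))"
proof -
  have "istopology (\<lambda>W. W \<subseteq> (\<Union>\<sigma>\<in>K. simplex_points \<sigma>) \<and>
     (\<forall>\<sigma>\<in>K. openin (top_of_set (simplex_points \<sigma>)) (W \<inter> simplex_points \<sigma>)))"
  proof -
    have 1: "openin (top_of_set A) (S \<inter> T \<inter> A)"
      if "openin (top_of_set A) (S \<inter> A)" "openin (top_of_set A) (T \<inter> A)" for S T A :: "('a \<Rightarrow> real) set"
    proof -
      have "S \<inter> T \<inter> A = (S \<inter> A) \<inter> (T \<inter> A)" by blast
      then show ?thesis using openin_Int[OF that] by metis
    qed
    have 2: "openin (top_of_set A) (\<Union>\<K> \<inter> A)"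
      if "\<forall>S\<in>\<K>. openin (top_of_set A) (S \<inter> A)" for \<K> and A :: "('a \<Rightarrow> real) set"
    proof -
      have "\<Union>\<K> \<inter> A = \<Union>((\<lambda>S. S \<inter> A) ` \<K>)" by blast
      moreover have "openin (top_of_set A) (\<Union>((\<lambda>S. S \<inter> A) ` \<K>))"
        using that by (intro openin_Union) blast
      ultimately show ?thesis by metis
    qed
    show ?thesis
    proof (unfold istopology_def, intro conjI allI impI ballI)
      fix S T :: "('a \<Rightarrow> real) set" and \<sigma>
      assume S: "S \<subseteq> (\<Union>\<sigma>\<in>K. simplex_points \<sigma>) \<and>
          (\<forall>\<sigma>\<in>K. openin (top_of_set (simplex_points \<sigma>)) (S \<inter> simplex_points \<sigma>))"
        and T: "T \<subseteq> (\<Union>\<sigma>\<in>K. simplex_points \<sigma>) \<and>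
          (\<forall>\<sigma>\<in>K. openin (top_of_set (simplex_points \<sigma>)) (T \<inter> simplex_points \<sigma>))"
      then show "S \<inter> T \<subseteq> (\<Union>\<sigma>\<in>K. simplex_points \<sigma>)" by blast
      show "openin (top_of_set (simplex_points \<sigma>)) (S \<inter> T \<inter> simplex_points \<sigma>)" if "\<sigma> \<in> K"
        using 1 S T that by blast
    next
      fix \<K> :: "('a \<Rightarrow> real) set set" and \<sigma>
      assume *: "\<forall>S\<in>\<K>. S \<subseteq> (\<Union>\<sigma>\<in>K. simplex_points \<sigma>) \<and>
          (\<forall>\<sigma>\<in>K. openin (top_of_set (simplex_points \<sigma>)) (S \<inter> simplex_points \<sigma>))"
      then show "\<Union>\<K> \<subseteq> (\<Union>\<sigma>\<in>K. simplex_points \<sigma>)" by blast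
      show "openin (top_of_set (simplex_points \<sigma>)) (\<Union>\<K> \<inter> simplex_points \<sigma>)" if "\<sigma> \<in> K"
        using 2 * that by blast
    qed
  qed
  then show ?thesis by (simp add: realization_def)
qed

definition vertex_point :: "'v \<Rightarrow> 'v \<Rightarrow> real" where
  "vertex_point v = (\<lambda>w. if w = v then 1 else 0)"

text \<open>The linear extension of a vertex map \<open>p\<close>.\<close>

definition simplicial_realization :: "('v \<Rightarrow> 'w) \<Rightarrow> ('v \<Rightarrow> real) \<Rightarrow> 'w \<Rightarrow> real" where
  "simplicial_realization p t = (\<lambda>w. \<Sum>v | t v \<noteq> 0 \<and> p v = w. t v)"

section \<open>The first Cech homotopy group\<close>

text \<open>Covers are sets of open sets, so a partition of unity subordinated to \<open>\<U>\<close> is indexed by the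
  members of \<open>\<U>\<close>; its values at other sets are irrelevant.\<close>

definition pointed_partition_of_unity ::
  "'a topology \<Rightarrow> 'a \<Rightarrow> 'a set set \<Rightarrow> 'a set \<Rightarrow> ('a set \<Rightarrow> 'a \<Rightarrow> real) \<Rightarrow> bool" where
  "pointed_partition_of_unity X x0 \<U> U0 \<phi> \<longleftrightarrow>
     (\<forall>U\<in>\<U>. continuous_map X euclideanreal (\<phi> U) \<and> (\<forall>x\<in>topspace X. 0 \<le> \<phi> U x) \<and>
             Abstract_Topology.closure_of X {x \<in> topspace X. \<phi> U x \<noteq> 0} \<subseteq> U) \<and>
     (\<forall>x\<in>topspace X. \<exists>W. openin X W \<and> x \<in> W \<and> finite {U\<in>\<U>. \<exists>y\<in>W. \<phi> U y \<noteq> 0}) \<and>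
     (\<forall>x\<in>topspace X. (\<Sum>U | U \<in> \<U> \<and> \<phi> U x \<noteq> 0. \<phi> U x) = 1) \<and>
     \<phi> U0 x0 = 1"

definition pointed_covers :: "'a topology \<Rightarrow> 'a \<Rightarrow> ('a set set \<times> 'a set) set" where
  "pointed_covers X x0 = {(\<U>, U0).
     (\<forall>U\<in>\<U>. openin X U) \<and> \<Union>\<U> = topspace X \<and> U0 \<in> \<U> \<and> x0 \<in> U0 \<and>
     (\<exists>\<phi>. pointed_partition_of_unity X x0 \<U> U0 \<phi>)}"

text \<open>\<open>p\<close> exhibits the first pointed cover as a pointed refinement of the second one.\<close>

fun refinement_projection ::
  "'a set set \<times> 'a set \<Rightarrow> 'a set set \<times> 'a set \<Rightarrow> ('a set \<Rightarrow> 'a set) \<Rightarrow> bool" where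
  "refinement_projection (\<V>, V0) (\<U>, U0) p \<longleftrightarrow> (\<forall>V\<in>\<V>. p V \<in> \<U> \<and> V \<subseteq> p V) \<and> p V0 = U0"

abbreviation nerve_space :: "'a set set \<times> 'a set \<Rightarrow> ('a set \<Rightarrow> real) topology" where
  "nerve_space i \<equiv> realization (nerve (fst i))"

abbreviation nerve_point :: "'a set set \<times> 'a set \<Rightarrow> 'a set \<Rightarrow> real" where
  "nerve_point i \<equiv> vertex_point (snd i)"

text \<open>The inverse limit, realized as the compatible families in the product. Different projections
  for one refinement induce the same bonding homomorphism, so it is harmless to demand
  compatibility for all of them.\<close>

definition cech_group ::
  "'a topology \<Rightarrow> 'a \<Rightarrow> ('a set set \<times> 'a set \<Rightarrow> (real \<Rightarrow> 'a set \<Rightarrow> real) set) monoid" where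
  "cech_group X x0 =
     \<lparr>carrier =
        {g \<in> (\<Pi>\<^sub>E i\<in>pointed_covers X x0.
                carrier (fundamental_group (nerve_space i) (nerve_point i))).
          \<forall>i\<in>pointed_covers X x0. \<forall>j\<in>pointed_covers X x0. \<forall>p. refinement_projection j i p \<longrightarrow>
            induced_hom (nerve_space i) (nerve_point i) (simplicial_realization p) (g j) = g i},
      monoid.mult = (\<lambda>g h. \<lambda>i\<in>pointed_covers X x0.
        g i \<otimes>\<^bsub>fundamental_group (nerve_space i) (nerve_point i)\<^esub> h i),
      one = (\<lambda>i\<in>pointed_covers X x0. \<one>\<^bsub>fundamental_group (nerve_space i) (nerve_point i)\<^esub>)\<rparr>"

definition nerve_map :: "'a set set \<Rightarrow> ('a set \<Rightarrow> 'a \<Rightarrow> real) \<Rightarrow> 'a \<Rightarrow> 'a set \<Rightarrow> real" where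
  "nerve_map \<U> \<phi> x = (\<lambda>U. if U \<in> \<U> then \<phi> U x else 0)"

text \<open>An arbitrary choice of partition of unity for each pointed cover; the pointed homotopy class
  of the resulting map to the nerve does not depend on it.\<close>

definition chosen_partition ::
  "'a topology \<Rightarrow> 'a \<Rightarrow> 'a set set \<times> 'a set \<Rightarrow> 'a set \<Rightarrow> 'a \<Rightarrow> real" where
  "chosen_partition X x0 i = (SOME \<phi>. pointed_partition_of_unity X x0 (fst i) (snd i) \<phi>)"

text \<open>The canonical homomorphism \<open>\<Psi>\<close> from \<open>fundamental_group X x0\<close> to \<open>cech_group X x0\<close>.\<close>

definition cech_hom ::
  "'a topology \<Rightarrow> 'a \<Rightarrow> (real \<Rightarrow> 'a) set \<Rightarrow> 'a set set \<times> 'a set \<Rightarrow> (real \<Rightarrow> 'a set \<Rightarrow> real) set" where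
  "cech_hom X x0 A = (\<lambda>i\<in>pointed_covers X x0.
     induced_hom (nerve_space i) (nerve_point i) (nerve_map (fst i) (chosen_partition X x0 i)) A)"

section \<open>The Hawaiian Earring and the Hawaiian Pants\<close>

text \<open>The plane is identified with \<^typ>\<open>complex\<close>, for which winding numbers are available.\<close>

definition hawaiian_earring :: "complex set" where
  "hawaiian_earring = (\<Union>n\<in>{1::nat..}. sphere (Complex (1 / real n) 0) (1 / real n))"

definition earring_loop :: "nat \<Rightarrow> real \<Rightarrow> complex" where
  "earring_loop n t =
     Complex (1 / real n * (1 - cos (2 * pi * t))) (1 / real n * sin (2 * pi * t))"

definition closed_disk :: "complex set \<Rightarrow> bool" where
  "closed_disk D \<longleftrightarrow> (\<exists>c r. 0 < r \<and> D = cball c r)"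

text \<open>\<open>g\<close> parametrizes the boundary of the closed disk \<open>D\<close> as a simple closed curve with clockwise
  orientation.\<close>

definition clockwise_boundary :: "complex set \<Rightarrow> (real \<Rightarrow> complex) \<Rightarrow> bool" where
  "clockwise_boundary D g \<longleftrightarrow>
     simple_path g \<and> pathfinish g = pathstart g \<and> path_image g = frontier D \<and>
     (\<forall>z\<in>interior D. winding_number g z = -1)"

definition pants :: "complex set \<Rightarrow> complex set \<Rightarrow> complex set \<Rightarrow> complex set" where
  "pants D D1 D2 = D - (interior D1 \<union> interior D2)"

definition pants_boundary :: "complex set \<Rightarrow> complex set \<Rightarrow> complex set \<Rightarrow> complex set" where
  "pants_boundary D D1 D2 = frontier D \<union> frontier D1 \<union> frontier D2"

definition quotient_topology :: "'a topology \<Rightarrow> ('a \<times> 'a) set \<Rightarrow> 'a set topology" where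
  "quotient_topology X R = topology (\<lambda>W. W \<subseteq> topspace X // R \<and> openin X (\<Union>W))"

lemma openin_quotient_topology:
  assumes "equiv (topspace X) R"
  shows "openin (quotient_topology X R) W \<longleftrightarrow> W \<subseteq> topspace X // R \<and> openin X (\<Union>W)"
proof -
  have 1: "\<Union>(S \<inter> T) = \<Union>S \<inter> \<Union>T" if "S \<subseteq> topspace X // R" "T \<subseteq> topspace X // R" for S T
    using that quotient_disj[OF assms] by blast
  have 2: "openin X (\<Union>(\<Union>\<K>))" if "\<forall>S\<in>\<K>. openin X (\<Union>S)" for \<K>
    proof -
    have "\<Union>(\<Union>\<K>) = \<Union>(Union ` \<K>)" by auto
    then show ?thesis using that openin_Union[of "Union ` \<K>" X] by (metis imageE)
  qed
  have "istopology (\<lambda>W. W \<subseteq> topspace X // R \<and> openin X (\<Union>W))"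
  proof (unfold istopology_def, intro conjI allI impI)
    fix S T assume S: "S \<subseteq> topspace X // R \<and> openin X (\<Union>S)"
      and T: "T \<subseteq> topspace X // R \<and> openin X (\<Union>T)"
    then show "S \<inter> T \<subseteq> topspace X // R" by blast
    show "openin X (\<Union>(S \<inter> T))" using S T 1[of S T] openin_Int by metis
  next
    fix \<K> assume "\<forall>K\<in>\<K>. K \<subseteq> topspace X // R \<and> openin X (\<Union>K)"
    then show "\<Union>\<K> \<subseteq> topspace X // R" "openin X (\<Union>(\<Union>\<K>))" using 2[of \<K>] by blast+
  qed
  then show ?thesis by (simp add: quotient_topology_def)
qed

text \<open>The disjoint union of the Earring (index \<open>0\<close>) and of the pairs of pants (indices \<open>n \<ge> 1\<close>).\<close>

definition pants_sum ::
  "(nat \<Rightarrow> complex set) \<Rightarrow> (nat \<Rightarrow> complex set) \<Rightarrow> (nat \<Rightarrow> complex set) \<Rightarrow> (nat \<times> complex) topology"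
where
  "pants_sum D D1 D2 =
     sum_topology (\<lambda>n. top_of_set (if n = 0 then hawaiian_earring else pants (D n) (D1 n) (D2 n))) UNIV"

text \<open>The equivalence relation on the disjoint union that is generated by gluing each boundary point
  \<open>z\<close> of the \<open>n\<close>-th pair of pants to \<open>f n z\<close>.\<close>

definition pants_glue ::
  "(nat \<Rightarrow> complex set) \<Rightarrow> (nat \<Rightarrow> complex set) \<Rightarrow> (nat \<Rightarrow> complex set) \<Rightarrow>
   (nat \<Rightarrow> complex \<Rightarrow> complex) \<Rightarrow> ((nat \<times> complex) \<times> (nat \<times> complex)) set"
where
  "pants_glue D D1 D2 f =
     {(x, y) \<in> topspace (pants_sum D D1 D2) \<times> topspace (pants_sum D D1 D2).
       equivclp (\<lambda>x y. \<exists>n\<ge>1. \<exists>z \<in> pants_boundary (D n) (D1 n) (D2 n).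
                   x = (n, z) \<and> y = (0, f n z)) x y}"

lemma equiv_pants_glue: "equiv (topspace (pants_sum D D1 D2)) (pants_glue D D1 D2 f)"
proof (rule equivI)
  show "refl_on (topspace (pants_sum D D1 D2)) (pants_glue D D1 D2 f)"
    by (rule refl_onI) (simp add: pants_glue_def)
  show "pants_glue D D1 D2 f \<subseteq> topspace (pants_sum D D1 D2) \<times> topspace (pants_sum D D1 D2)"
    unfolding pants_glue_def by blast
  show "sym (pants_glue D D1 D2 f)"
    unfolding pants_glue_def by (rule symI) (blast intro: equivclp_sym)
  show "trans (pants_glue D D1 D2 f)"
    unfolding pants_glue_def by (rule transI) (blast intro: equivclp_trans)
qed

definition hawaiian_pants ::
  "(nat \<Rightarrow> complex set) \<Rightarrow> (nat \<Rightarrow> complex set) \<Rightarrow> (nat \<Rightarrow> complex set) \<Rightarrow>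
   (nat \<Rightarrow> complex \<Rightarrow> complex) \<Rightarrow> (nat \<times> complex) set topology"
where
  "hawaiian_pants D D1 D2 f = quotient_topology (pants_sum D D1 D2) (pants_glue D D1 D2 f)"

definition pants_basepoint ::
  "(nat \<Rightarrow> complex set) \<Rightarrow> (nat \<Rightarrow> complex set) \<Rightarrow> (nat \<Rightarrow> complex set) \<Rightarrow>
   (nat \<Rightarrow> complex \<Rightarrow> complex) \<Rightarrow> (nat \<times> complex) set"
where
  "pants_basepoint D D1 D2 f = pants_glue D D1 D2 f `` {(0, 0)}"

end

theory Submission
  imports Defs
begin

text \<open>The witness is the loop \<open>\<ell>\<^sub>1\<close>. If a map from the Hawaiian Pants to some space makes the loops
  with indices \<open>2n\<close> and \<open>2n + 1\<close> null-homotopic, then it extends over the two holes of the \<open>n\<close>-th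
  pair of pants, and hence it makes \<open>\<ell>\<^sub>n\<close> null-homotopic as well. In the nerve of a pointed cover all small
  \<open>\<ell>\<^sub>m\<close> run in the contractible open star of the base vertex, so downward induction kills \<open>\<ell>\<^sub>1\<close>.
  Conversely, the image of a null-homotopy in the Hawaiian Pants is compact and therefore meets the
  interiors of finitely many pairs of pants only. The map to the punctured plane that has degree
  \<open>-1\<close> on the circles \<open>2\<^sup>j\<close>, \<open>j \<le> J\<close>, and degree \<open>0\<close> on the others extends over these pairs of pants
  for large \<open>J\<close>, and then winding numbers show that \<open>\<ell>\<^sub>1\<close> is not null-homotopic.\<close>

section \<open>Loop homotopies and disks\<close>

lemma loop_homotopic_iff:
  "loop_homotopic Y y0 p q \<longleftrightarrow>
    (\<exists>k. continuous_map (top_of_set ({0..1::real} \<times> {0..1::real})) Y k \<and>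
         (\<forall>t\<in>{0..1}. k (0, t) = p t \<and> k (1, t) = q t) \<and>
         (\<forall>s\<in>{0..1}. k (s, 0) = y0 \<and> k (s, 1) = y0))"
proof -
  have "prod_topology (top_of_set {0..1::real}) (top_of_set {0..1::real}) = top_of_set ({0..1} \<times> {0..1})"
    by simp
  then show ?thesis
    unfolding loop_homotopic_def
    by (subst homotopic_with) (auto simp only: topspace_euclidean_subtopology ball_conj_distrib atLeastAtMost_iff
      zero_le_one order_refl)
qed

lemma loop_homotopicE:
  assumes "loop_homotopic Y y0 p q"
  obtains k where "continuous_map (top_of_set ({0..1::real} \<times> {0..1::real})) Y k"
    "\<And>t. t \<in> {0..1} \<Longrightarrow> k (0, t) = p t" "\<And>t. t \<in> {0..1} \<Longrightarrow> k (1, t) = q t"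
    "\<And>s. s \<in> {0..1} \<Longrightarrow> k (s, 0) = y0" "\<And>s. s \<in> {0..1} \<Longrightarrow> k (s, 1) = y0"
  using assms unfolding loop_homotopic_iff by (elim exE conjE) (rule that, assumption, auto)

lemma loop_homotopic_sym: "loop_homotopic Y y0 p q \<Longrightarrow> loop_homotopic Y y0 q p"
  by (simp add: loop_homotopic_def homotopic_with_sym)

lemma loop_homotopic_trans:
  "loop_homotopic Y y0 p q \<Longrightarrow> loop_homotopic Y y0 q r \<Longrightarrow> loop_homotopic Y y0 p r"
  unfolding loop_homotopic_def by (rule homotopic_with_trans)

lemma loop_class_eq:
  assumes "loop_homotopic Y y0 p q"
  shows "loop_class Y y0 p = loop_class Y y0 q"
  using loop_homotopic_trans[OF assms] loop_homotopic_trans[OF loop_homotopic_sym[OF assms]]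
  unfolding loop_class_def by (intro Collect_cong iffI)

lemma loop_homotopic_refl: "loop_in Y y0 p \<Longrightarrow> loop_homotopic Y y0 p p"
  by (simp add: loop_homotopic_def loop_in_def pathin_def)

lemma loop_homotopic_compose:
  "loop_homotopic X x0 p q \<Longrightarrow> continuous_map X Y h \<Longrightarrow> loop_homotopic Y (h x0) (h \<circ> p) (h \<circ> q)"
  unfolding loop_homotopic_def
  by (erule homotopic_with_compose_continuous_map_left) auto

text \<open>Loops are functions on all reals, but only their values on the unit interval count. The
  boundary curves and \<open>f\<close> are tied to the earring loops on that interval only, so this
  is how one loop is replaced by another.\<close>

lemma loop_homotopic_eq:
  assumes "loop_homotopic Y y0 p q" "\<And>t. t \<in> {0..1} \<Longrightarrow> p' t = p t"
  shows "loop_homotopic Y y0 p' q"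
proof -
  obtain k where k: "continuous_map (top_of_set ({0..1::real} \<times> {0..1::real})) Y k"
    "\<And>t. t \<in> {0..1} \<Longrightarrow> k (0, t) = p t" "\<And>t. t \<in> {0..1} \<Longrightarrow> k (1, t) = q t"
    "\<And>s. s \<in> {0..1} \<Longrightarrow> k (s, 0) = y0" "\<And>s. s \<in> {0..1} \<Longrightarrow> k (s, 1) = y0"
    using assms(1) by (rule loop_homotopicE) blast
  then show ?thesis
    unfolding loop_homotopic_iff by (intro exI[of _ k]) (simp add: assms(2))
qed

text \<open>Contract \<open>a\<close> to its starting point along straight lines inside the convex
  set and push the contraction forward by \<open>E\<close>. As \<open>a\<close> is closed, the end
  points stay put throughout.\<close>

lemma loop_homotopic_disk:
  fixes S :: "'a::real_normed_vector set"
  assumes E: "continuous_map (top_of_set S) Y E" and "convex S"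
    and a: "path a" "path_image a \<subseteq> S" "pathfinish a = pathstart a" and y0: "E (a 0) = y0"
  shows "loop_homotopic Y y0 (E \<circ> a) (\<lambda>_. y0)"
proof -
  let ?q = "\<lambda>(s, t). (1 - s) *\<^sub>R a t + s *\<^sub>R a 0"
  have aS: "a t \<in> S" if "t \<in> {0..1}" for t using a(2) that by (auto simp: path_image_def)
  have "continuous_on ({0..1} \<times> {0..1}) ?q"
    unfolding case_prod_unfold
    by (intro continuous_intros continuous_on_compose2[OF a(1)[unfolded path_def]]) auto
  moreover have "?q ` ({0..1} \<times> {0..1}) \<subseteq> S"
    using \<open>convex S\<close> aS by (auto simp: convex_def)
  ultimately have "continuous_map (top_of_set ({0..1} \<times> {0..1})) Y (E \<circ> ?q)"
    by (intro continuous_map_compose[OF _ E]) (auto simp: continuous_map_in_subtopology)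
  moreover have "a 1 = a 0" using a(3) by (simp add: pathfinish_def pathstart_def)
  ultimately show ?thesis
    unfolding loop_homotopic_iff
    by (intro exI[of _ "E \<circ> ?q"]) (auto simp: y0 algebra_simps)
qed

text \<open>Polar coordinates present the disk as a quotient of the unit square: \<open>t\<close>
  runs along \<open>b\<close>, and \<open>s\<close> moves from the boundary (\<open>s = 0\<close>)
  to the centre (\<open>s = 1\<close>). A null-homotopy is constant on the fibres of this quotient
  map and thus descends to the disk.\<close>

lemma disk_extension:
  fixes c :: complex
  assumes r: "0 < r" and b: "simple_path b" "pathfinish b = pathstart b" "path_image b = sphere c r"
    and null: "loop_homotopic Y y0 (G \<circ> b) (\<lambda>_. y0)"
  obtains E where "continuous_map (top_of_set (cball c r)) Y E" "\<And>z. z \<in> sphere c r \<Longrightarrow> E z = G z"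
proof -
  let ?sq = "{0..1} \<times> {0..1} :: (real \<times> real) set"
  obtain k where k: "continuous_map (top_of_set ?sq) Y k"
    "\<And>t. t \<in> {0..1} \<Longrightarrow> k (0, t) = (G \<circ> b) t" "\<And>t. t \<in> {0..1} \<Longrightarrow> k (1, t) = y0"
    "\<And>s. s \<in> {0..1} \<Longrightarrow> k (s, 0) = y0" "\<And>s. s \<in> {0..1} \<Longrightarrow> k (s, 1) = y0"
    using null by (rule loop_homotopicE) blast
  define q where "q = (\<lambda>(s, t). c + (1 - s) *\<^sub>R (b t - c))"
  have bs: "norm (b t - c) = r" if "t \<in> {0..1}" for t
    using b(3) that by (auto simp: path_image_def dist_norm norm_minus_commute)
  have contb: "continuous_on {0..1} b" using b(1) by (simp add: simple_path_def path_def)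
  have "continuous_on ?sq q"
    unfolding q_def case_prod_unfold
    by (intro continuous_intros continuous_on_compose2[OF contb]) auto
  moreover have "q ` ?sq = cball c r"
  proof
    show "q ` ?sq \<subseteq> cball c r"
      using r bs by (auto simp: q_def dist_norm mult_left_le_one_le)
    show "cball c r \<subseteq> q ` ?sq"
    proof
      fix z assume z: "z \<in> cball c r"
      show "z \<in> q ` ?sq"
      proof (cases "z = c")
        case True
        then show ?thesis by (intro image_eqI[of _ _ "(1, 0)"]) (auto simp: q_def)
      next
        case False
        define d where "d = dist c z"
        have d: "0 < d" "d \<le> r" using False z by (auto simp: d_def)
        have "c + (r / d) *\<^sub>R (z - c) \<in> sphere c r"
          using d r by (simp add: dist_norm d_def norm_minus_commute)
        then obtain t where t: "t \<in> {0..1}" "b t = c + (r / d) *\<^sub>R (z - c)"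
          using b(3) unfolding path_image_def by (metis imageE)
        \<comment> \<open>The point at distance \<open>d\<close> from the centre has radial factor
          \<open>1 - s = d / r\<close>.\<close>
        have "z = q (1 - d / r, t)" using d r t by (simp add: q_def)
        then show ?thesis using t d r by (intro image_eqI) auto
      qed
    qed
  qed
  \<comment> \<open>A continuous surjection from a compact space onto a Hausdorff space is a
    quotient map.\<close>
  ultimately have quo: "quotient_map (top_of_set ?sq) (top_of_set (cball c r)) q"
    by (intro continuous_imp_quotient_map)
       (auto simp: compact_space_subtopology compactin_euclidean_iff compact_Times
         Hausdorff_space_subtopology Hausdorff_space_euclidean)
  \<comment> \<open>Comparing distances from \<open>c\<close> gives \<open>s = s'\<close>. The fibre
    over the centre is the edge \<open>s = 1\<close>, where \<open>k\<close> is constantly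
    \<open>y0\<close>; any other fibre with two points pairs \<open>t = 0\<close> with
    \<open>t = 1\<close>, where \<open>k\<close> is again \<open>y0\<close>.\<close>
  have fib: "k x = k y" if "x \<in> topspace (top_of_set ?sq)" "y \<in> topspace (top_of_set ?sq)" "q x = q y" for x y
  proof -
    obtain s t s' t' where xy: "x = (s, t)" "y = (s', t')" by (meson surj_pair)
    have e: "(1 - s) *\<^sub>R (b t - c) = (1 - s') *\<^sub>R (b t' - c)" using that xy by (simp add: q_def)
    then have "norm ((1 - s) *\<^sub>R (b t - c)) = norm ((1 - s') *\<^sub>R (b t' - c))" by simp
    then have s: "s = s'" using bs that xy r by auto
    show ?thesis
    proof (cases "s = 1")
      case True
      then show ?thesis using k(3) xy s that by auto
    next
      case False
      then have "b t = b t'" using e s by simp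
      then have "t = t' \<or> t = 0 \<and> t' = 1 \<or> t = 1 \<and> t' = 0"
        using b(1) that xy by (auto simp: simple_path_def loop_free_def)
      then show ?thesis using k(4,5) xy s that by auto
    qed
  qed
  obtain E where E: "continuous_map (top_of_set (cball c r)) Y E"
    "\<And>x. x \<in> topspace (top_of_set ?sq) \<Longrightarrow> E (q x) = k x"
  proof (rule quotient_map_lift_exists[OF quo k(1)])
    show "k x = k y" if "x \<in> topspace (top_of_set ?sq)" "y \<in> topspace (top_of_set ?sq)" "q x = q y" for x y
      using that by (rule fib)
  qed (rule that)
  show ?thesis
  proof
    show "continuous_map (top_of_set (cball c r)) Y E" by fact
    fix z assume "z \<in> sphere c r"
    then obtain t where t: "t \<in> {0..1}" "z = b t" using b(3) unfolding path_image_def by blast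
    have "E (q (0, t)) = k (0, t)" by (rule E) (use t in auto)
    then show "E z = G z" using k(2) t by (simp add: q_def)
  qed
qed

lemma clockwise_boundary_sphere:
  assumes "clockwise_boundary D g" "D = cball c r" "0 < r"
  shows "simple_path g" "pathfinish g = pathstart g" "path_image g = sphere c r" "g 1 = g 0"
    "path g"
  using assms
  by (auto simp: clockwise_boundary_def frontier_cball pathfinish_def pathstart_def simple_path_imp_path)

text \<open>The null-homotopies along the inner boundaries fill both holes, so \<open>G\<close>
  extends to the whole disk \<open>D\<close>, in which the outer boundary contracts.\<close>

lemma pants_boundary_null:
  assumes disks: "closed_disk D" "closed_disk D1" "closed_disk D2"
    and inside: "D1 \<subseteq> interior D" "D2 \<subseteq> interior D" and disj: "D1 \<inter> D2 = {}"
    and a: "clockwise_boundary D a" and b: "clockwise_boundary D1 b" and g: "clockwise_boundary D2 g"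
    and G: "continuous_map (top_of_set (pants D D1 D2)) Y G" and y0: "G (a 0) = y0"
    and null: "loop_homotopic Y y0 (G \<circ> b) (\<lambda>_. y0)" "loop_homotopic Y y0 (G \<circ> g) (\<lambda>_. y0)"
  shows "loop_homotopic Y y0 (G \<circ> a) (\<lambda>_. y0)"
proof -
  obtain c r c1 r1 c2 r2 where D: "D = cball c r" "0 < r" "D1 = cball c1 r1" "0 < r1"
    "D2 = cball c2 r2" "0 < r2"
    using disks unfolding closed_disk_def by blast
  obtain E1 where E1: "continuous_map (top_of_set D1) Y E1" "\<And>z. z \<in> sphere c1 r1 \<Longrightarrow> E1 z = G z"
    using disk_extension[OF D(4) clockwise_boundary_sphere(1-3)[OF b D(3,4)] null(1)] D(3) by metis
  obtain E2 where E2: "continuous_map (top_of_set D2) Y E2" "\<And>z. z \<in> sphere c2 r2 \<Longrightarrow> E2 z = G z"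
    using disk_extension[OF D(6) clockwise_boundary_sphere(1-3)[OF g D(5,6)] null(2)] D(5) by metis
  define E where "E z = (if z \<in> D1 then E1 z else if z \<in> D2 then E2 z else G z)" for z
  define T where "T i = (if i = 0 then pants D D1 D2 else if i = 1 then D1 else D2)" for i :: nat
  define e where "e i = (if i = 0 then G else if i = 1 then E1 else E2)" for i :: nat
  have clo: "closed (T i)" for i
    using D by (auto simp: T_def pants_def)
  have TD: "T i \<subseteq> D" for i
    using inside interior_subset[of D] by (auto simp: T_def pants_def)
  have sph: "z \<in> sphere c1 r1" if "z \<in> D1" "z \<in> pants D D1 D2" for z
    using that D by (auto simp: pants_def)
  have sph2: "z \<in> sphere c2 r2" if "z \<in> D2" "z \<in> pants D D1 D2" for z
    using that D by (auto simp: pants_def)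
  \<comment> \<open>The pieces 0, 1, 2 are the pants and the two filled holes. They are closed, and
    they overlap only in the inner boundary circles, where \<open>E1\<close> and \<open>E2\<close>
    agree with \<open>G\<close>.\<close>
  have E: "continuous_map (top_of_set D) Y E"
  proof (rule pasting_lemma_closed[where I = "{0,1,2::nat}" and T = T and f = e])
    fix i :: nat assume "i \<in> {0,1,2}"
    show "closedin (top_of_set D) (T i)" using clo TD by (simp add: closed_subset)
    have "continuous_map (top_of_set (T i)) Y (e i)"
      using G E1 E2 by (auto simp: T_def e_def)
    then show "continuous_map (subtopology (top_of_set D) (T i)) Y (e i)"
      using TD by (simp add: subtopology_subtopology inf.absorb2)
  next
    fix i j :: nat and x assume "i \<in> {0,1,2}" "j \<in> {0,1,2}" "x \<in> topspace (top_of_set D) \<inter> T i \<inter> T j"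
    then show "e i x = e j x"
      using disj sph[of x] sph2[of x] E1(2)[of x] E2(2)[of x]
      by (auto simp: e_def T_def split: if_splits)
  next
    fix x assume "x \<in> topspace (top_of_set D)"
    then consider "x \<in> D1" | "x \<notin> D1" "x \<in> D2" | "x \<notin> D1" "x \<notin> D2" "x \<in> pants D D1 D2"
      using interior_subset by (fastforce simp: pants_def)
    then show "\<exists>j. j \<in> {0,1,2} \<and> x \<in> T j \<and> E x = e j x"
      by cases (force simp: T_def e_def E_def)+
  qed simp
  note a' = clockwise_boundary_sphere[OF a D(1,2)]
  have "a t \<notin> D1 \<and> a t \<notin> D2" if "t \<in> {0..1}" for t
  proof -
    have "a t \<in> sphere c r" using a'(3) that by (auto simp: path_image_def)
    then show ?thesis using inside D(1,2) by auto
  qed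
  then have Ea: "E (a t) = G (a t)" if "t \<in> {0..1}" for t
    using that by (auto simp: E_def)
  have "loop_homotopic Y y0 (E \<circ> a) (\<lambda>_. y0)"
    by (rule loop_homotopic_disk[OF E]) (use D a' Ea[of 0] y0 in auto)
  then show ?thesis by (rule loop_homotopic_eq) (simp add: Ea)
qed

section \<open>Maps into nerves\<close>

lemma topspace_realization: "topspace (realization K) = (\<Union>\<sigma>\<in>K. simplex_points \<sigma>)"
proof
  show "topspace (realization K) \<subseteq> (\<Union>\<sigma>\<in>K. simplex_points \<sigma>)"
    using openin_topspace[of "realization K"] openin_realization by metis
  have "(\<Union>\<sigma>\<in>K. simplex_points \<sigma>) \<inter> simplex_points \<sigma> = simplex_points \<sigma>" if "\<sigma> \<in> K" for \<sigma>
    using that by blast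
  then have "openin (realization K) (\<Union>\<sigma>\<in>K. simplex_points \<sigma>)"
    by (simp add: openin_realization)
  then show "(\<Union>\<sigma>\<in>K. simplex_points \<sigma>) \<subseteq> topspace (realization K)"
    by (rule openin_subset)
qed

lemma simplex_points_mono:
  assumes "\<sigma> \<subseteq> \<tau>" "finite \<tau>"
  shows "simplex_points \<sigma> \<subseteq> simplex_points \<tau>"
proof
  fix t assume t: "t \<in> simplex_points \<sigma>"
  have "(\<Sum>v\<in>\<tau>. t v) = (\<Sum>v\<in>\<sigma>. t v)"
    by (rule sum.mono_neutral_right) (use assms t in \<open>auto simp: simplex_points_def\<close>)
  then show "t \<in> simplex_points \<tau>"
    using t assms by (auto simp: simplex_points_def)
qed

text \<open>The weak topology may be finer than the product topology, so continuity of the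
  coordinates alone does not suffice. Local finiteness repairs this: near each point only finitely
  many simplices have to be considered, and on each of them the two topologies agree.\<close>

lemma continuous_map_realization:
  fixes g :: "'a \<Rightarrow> 'v \<Rightarrow> real"
  assumes coord: "\<And>v. continuous_map Z euclideanreal (\<lambda>z. g z v)"
    and lf: "\<And>z. z \<in> topspace Z \<Longrightarrow> \<exists>W. openin Z W \<and> z \<in> W \<and> finite {v. \<exists>y\<in>W. g y v \<noteq> 0}"
    and supp: "\<And>z. z \<in> topspace Z \<Longrightarrow> {v. g z v \<noteq> 0} \<in> K"
    and simp: "\<And>z. z \<in> topspace Z \<Longrightarrow> g z \<in> simplex_points {v. g z v \<noteq> 0}"
  shows "continuous_map Z (realization K) g"
  unfolding continuous_map_def
proof (intro conjI allI impI)
  show "g \<in> topspace Z \<rightarrow> topspace (realization K)"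
    using supp simp by (auto simp: topspace_realization)
  have cont: "continuous_map Z euclidean g"
    unfolding euclidean_product_topology [symmetric] continuous_map_componentwise_UNIV
    using coord by blast
  fix Q assume Q: "openin (realization K) Q"
  have "\<forall>\<sigma>\<in>K. \<exists>V. open V \<and> Q \<inter> simplex_points \<sigma> = simplex_points \<sigma> \<inter> V"
    using Q by (simp add: openin_realization openin_open)
  then obtain V where V: "\<And>\<sigma>. \<sigma> \<in> K \<Longrightarrow> open (V \<sigma>)"
      "\<And>\<sigma>. \<sigma> \<in> K \<Longrightarrow> Q \<inter> simplex_points \<sigma> = simplex_points \<sigma> \<inter> V \<sigma>"
    by metis
  let ?s = "\<lambda>z. {v. g z v \<noteq> 0}"
  show "openin Z {x \<in> topspace Z. g x \<in> Q}"
  proof (subst openin_subopen, intro ballI)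
    fix x assume "x \<in> {x \<in> topspace Z. g x \<in> Q}"
    then have x: "x \<in> topspace Z" "g x \<in> Q" by auto
    obtain W where W: "openin Z W" "x \<in> W" "finite {v. \<exists>y\<in>W. g y v \<noteq> 0}"
      using lf x by blast
    define F where "F = {v. \<exists>y\<in>W. g y v \<noteq> 0}"
    \<comment> \<open>The finitely many simplices that can be the support of a point near
      \<open>x\<close>.\<close>
    define T where "T = {\<sigma>\<in>K. \<sigma> \<subseteq> F \<and> ?s x \<subseteq> \<sigma>}"
    have finF: "finite F" using W by (simp add: F_def)
    have finT: "finite T" using finF by (auto simp: T_def intro: finite_subset[of _ "Pow F"])
    have sxF: "?s x \<subseteq> F" using W by (auto simp: F_def)
    then have fins: "finite (?s x)" using finF finite_subset by blast
    \<comment> \<open>On \<open>N\<close> the coordinates that are nonzero at \<open>x\<close> stay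
      nonzero, so the support of \<open>g y\<close> contains that of \<open>g x\<close> and belongs
      to \<open>T\<close>. The last condition then puts \<open>g y\<close> into \<open>Q\<close>,
      whichever member of \<open>T\<close> this support is.\<close>
    define N where "N = W \<inter> ((\<Inter>v\<in>?s x. {z \<in> topspace Z. g z v \<in> -{0}}) \<inter> topspace Z)
       \<inter> ((\<Inter>\<sigma>\<in>T. {z \<in> topspace Z. g z \<in> V \<sigma>}) \<inter> topspace Z)"
    have "openin Z {z \<in> topspace Z. g z v \<in> -{0}}" for v
      using coord[of v] by (rule openin_continuous_map_preimage) auto
    moreover have "openin Z {z \<in> topspace Z. g z \<in> V \<sigma>}" if "\<sigma> \<in> T" for \<sigma>
      using cont by (rule openin_continuous_map_preimage) (use V that in \<open>auto simp: T_def\<close>)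
    ultimately have "openin Z N"
      unfolding N_def using fins finT W(1) by (intro openin_Int openin_INT) auto
    moreover have "x \<in> N"
    proof -
      \<comment> \<open>Here \<open>g x\<close> lies in every simplex of \<open>T\<close>, since its
        support is a face of each of them; hence membership in \<open>Q\<close> means membership in
        \<open>V\<close> of that simplex.\<close>
      have "g x \<in> V \<sigma>" if "\<sigma> \<in> T" for \<sigma>
      proof -
        have "\<sigma> \<in> K" "finite \<sigma>" "?s x \<subseteq> \<sigma>" using that finF finite_subset by (auto simp: T_def)
        then show ?thesis using simplex_points_mono simp[OF x(1)] V(2) x(2) by blast
      qed
      then show ?thesis using x W by (auto simp: N_def)
    qed
    moreover have "N \<subseteq> {x \<in> topspace Z. g x \<in> Q}"
    proof
      fix y assume y: "y \<in> N"
      then have yt: "y \<in> topspace Z" by (auto simp: N_def)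
      have "?s y \<in> T" using y supp[OF yt] by (auto simp: T_def F_def N_def)
      then show "y \<in> {x \<in> topspace Z. g x \<in> Q}"
        using y yt simp[OF yt] V(2)[of "?s y"] by (auto simp: N_def T_def)
    qed
    ultimately show "\<exists>T. openin Z T \<and> x \<in> T \<and> T \<subseteq> {x \<in> topspace Z. g x \<in> Q}" by blast
  qed
qed

lemma nerve_face: "\<sigma> \<in> nerve \<U> \<Longrightarrow> \<tau> \<subseteq> \<sigma> \<Longrightarrow> \<tau> \<noteq> {} \<Longrightarrow> \<tau> \<in> nerve \<U>"
  unfolding nerve_def by (blast intro: finite_subset)

section \<open>Maps to the nerve given by pointed partitions of unity\<close>

context
  fixes X :: "'a topology" and x0 :: 'a and \<U> :: "'a set set" and U0 :: "'a set"
    and \<phi> :: "'a set \<Rightarrow> 'a \<Rightarrow> real"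
  assumes pou: "pointed_partition_of_unity X x0 \<U> U0 \<phi>" and U0: "U0 \<in> \<U>"
begin

lemma nerve_map_locally_finite:
  assumes "x \<in> topspace X"
  obtains W where "openin X W" "x \<in> W" "finite {U. \<exists>y\<in>W. nerve_map \<U> \<phi> y U \<noteq> 0}"
proof -
  obtain W where W: "openin X W" "x \<in> W" "finite {U\<in>\<U>. \<exists>y\<in>W. \<phi> U y \<noteq> 0}"
    using pou assms unfolding pointed_partition_of_unity_def by blast
  have "{U. \<exists>y\<in>W. nerve_map \<U> \<phi> y U \<noteq> 0} = {U\<in>\<U>. \<exists>y\<in>W. \<phi> U y \<noteq> 0}"
    by (auto simp: nerve_map_def)
  with W(3) have "finite {U. \<exists>y\<in>W. nerve_map \<U> \<phi> y U \<noteq> 0}" by simp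
  with W(1,2) show ?thesis by (rule that)
qed

text \<open>The closed support of each function lies in its own cover set, so all sets with nonzero
  coordinate at \<open>x\<close> contain \<open>x\<close>. They therefore have a common point and
  span a simplex of the nerve.\<close>

lemma nerve_map_support:
  assumes x: "x \<in> topspace X"
  shows "{U. nerve_map \<U> \<phi> x U \<noteq> 0} \<in> nerve \<U>"
    and "nerve_map \<U> \<phi> x \<in> simplex_points {U. nerve_map \<U> \<phi> x U \<noteq> 0}"
proof -
  have eq: "{U. nerve_map \<U> \<phi> x U \<noteq> 0} = {U \<in> \<U>. \<phi> U x \<noteq> 0}"
    by (auto simp: nerve_map_def)
  obtain W where W: "x \<in> W" "finite {U. \<exists>y\<in>W. nerve_map \<U> \<phi> y U \<noteq> 0}"
    by (rule nerve_map_locally_finite[OF x])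
  have "{U. nerve_map \<U> \<phi> x U \<noteq> 0} \<subseteq> {U. \<exists>y\<in>W. nerve_map \<U> \<phi> y U \<noteq> 0}"
    using W(1) by blast
  then have fin: "finite {U. nerve_map \<U> \<phi> x U \<noteq> 0}"
    using W(2) by (rule finite_subset)
  have sum: "(\<Sum>U | U \<in> \<U> \<and> \<phi> U x \<noteq> 0. \<phi> U x) = 1"
    using pou x by (auto simp: pointed_partition_of_unity_def)
  then have ne: "{U \<in> \<U>. \<phi> U x \<noteq> 0} \<noteq> {}" by force
  have "x \<in> U" if "U \<in> \<U>" "\<phi> U x \<noteq> 0" for U
  proof -
    have "x \<in> X closure_of {x \<in> topspace X. \<phi> U x \<noteq> 0}"
      using that x by (intro subsetD[OF closure_of_subset]) auto
    then show ?thesis using pou that by (auto simp: pointed_partition_of_unity_def)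
  qed
  then show "{U. nerve_map \<U> \<phi> x U \<noteq> 0} \<in> nerve \<U>"
    unfolding nerve_def using fin ne unfolding eq by blast
  have "(\<Sum>U | U \<in> \<U> \<and> \<phi> U x \<noteq> 0. nerve_map \<U> \<phi> x U) = 1"
    using sum by (simp add: nerve_map_def)
  moreover have "0 \<le> nerve_map \<U> \<phi> x U" for U
    using pou x by (auto simp: pointed_partition_of_unity_def nerve_map_def)
  ultimately show "nerve_map \<U> \<phi> x \<in> simplex_points {U. nerve_map \<U> \<phi> x U \<noteq> 0}"
    unfolding simplex_points_def eq[symmetric] by blast
qed

lemma continuous_map_nerve_map_coordinate:
  "continuous_map X euclideanreal (\<lambda>x. nerve_map \<U> \<phi> x U)"
  using pou by (cases "U \<in> \<U>") (auto simp: nerve_map_def pointed_partition_of_unity_def)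

lemma continuous_map_nerve_map: "continuous_map X (realization (nerve \<U>)) (nerve_map \<U> \<phi>)"
proof (rule continuous_map_realization)
  fix x assume x: "x \<in> topspace X"
  show "\<exists>W. openin X W \<and> x \<in> W \<and> finite {U. \<exists>y\<in>W. nerve_map \<U> \<phi> y U \<noteq> 0}"
    by (rule nerve_map_locally_finite[OF x]) (intro exI conjI)
  show "{U. nerve_map \<U> \<phi> x U \<noteq> 0} \<in> nerve \<U>"
    "nerve_map \<U> \<phi> x \<in> simplex_points {U. nerve_map \<U> \<phi> x U \<noteq> 0}"
    using nerve_map_support[OF x] by this
qed (rule continuous_map_nerve_map_coordinate)

text \<open>The coordinate at \<open>U0\<close> is already 1, so the remaining coordinates are
  nonnegative with sum 0.\<close>

lemma nerve_map_basepoint: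
  assumes x0: "x0 \<in> topspace X"
  shows "nerve_map \<U> \<phi> x0 = vertex_point U0"
proof -
  let ?m = "nerve_map \<U> \<phi> x0"
  have one: "?m U0 = 1"
    using pou U0 by (simp add: nerve_map_def pointed_partition_of_unity_def)
  let ?S = "{U. ?m U \<noteq> 0}"
  have fin: "finite ?S" using nerve_map_support(1)[OF x0] by (simp add: nerve_def)
  have sum: "(\<Sum>U\<in>?S. ?m U) = 1" and nn: "\<And>U. 0 \<le> ?m U"
    using nerve_map_support(2)[OF x0] by (auto simp: simplex_points_def)
  have "(\<Sum>U\<in>?S - {U0}. ?m U) = 0"
    using sum.remove[of ?S U0 ?m] fin one sum by auto
  then have "\<forall>U\<in>?S - {U0}. ?m U = 0"
    using fin nn by (subst (asm) sum_nonneg_eq_0_iff) auto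
  then show ?thesis using one by (auto simp: vertex_point_def fun_eq_iff)
qed

text \<open>The loop is contracted along straight lines in the open star of the vertex \<open>U0\<close>.\<close>

lemma nerve_map_star_null:
  assumes p: "pathin X p" and star: "\<And>t. t \<in> {0..1} \<Longrightarrow> \<phi> U0 (p t) > 0"
    and x0: "x0 \<in> topspace X" and ends: "p 0 = x0" "p 1 = x0"
  shows "loop_homotopic (realization (nerve \<U>)) (vertex_point U0) (nerve_map \<U> \<phi> \<circ> p)
    (\<lambda>_. vertex_point U0)"
proof -
  let ?sq = "{0..1} \<times> {0..1} :: (real \<times> real) set"
  let ?m = "nerve_map \<U> \<phi>"
  define k where "k = (\<lambda>(s::real, t). \<lambda>U. (1 - s) * ?m (p t) U + s * vertex_point U0 U)"
  have contp: "continuous_map (top_of_set {0..1}) X p" using p by (simp add: pathin_def)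
  have snd: "continuous_map (top_of_set ?sq) (top_of_set {0..1}) snd"
    by (auto simp: continuous_map_in_subtopology intro!: continuous_intros)
  have pt: "p t \<in> topspace X" if "t \<in> {0..1}" for t
    using continuous_map_image_subset_topspace[OF contp] that by auto
  have mU0: "?m (p t) U0 > 0" if "t \<in> {0..1}" for t
    using star[OF that] U0 by (simp add: nerve_map_def)
  \<comment> \<open>Since \<open>U0\<close> is already in the support of the starting point, moving
    towards its vertex adds no new vertex. Every segment thus stays in one simplex, and the local
    finiteness of the nerve map carries over to \<open>k\<close>.\<close>
  have sub: "{U. k (s, t) U \<noteq> 0} \<subseteq> {U. ?m (p t) U \<noteq> 0}" if "t \<in> {0..1}" for s t
    using mU0[OF that] by (auto simp: k_def vertex_point_def split: if_splits)
  have nn: "0 \<le> ?m (p t) U" if "t \<in> {0..1}" for t U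
    using nerve_map_support(2)[OF pt[OF that]] by (simp add: simplex_points_def)
  have "continuous_map (top_of_set ?sq) (realization (nerve \<U>)) k"
  proof (rule continuous_map_realization)
    fix U
    have "continuous_map (top_of_set ?sq) euclideanreal (\<lambda>z. ?m (p (snd z)) U)"
      using continuous_map_compose[OF continuous_map_compose[OF snd contp]
          continuous_map_nerve_map_coordinate[of U]] by (simp add: o_def)
    then have "continuous_on ?sq (\<lambda>z. ?m (p (snd z)) U)" by simp
    then have "continuous_on ?sq (\<lambda>z. k z U)"
      unfolding k_def case_prod_unfold by (intro continuous_intros)
    then show "continuous_map (top_of_set ?sq) euclideanreal (\<lambda>z. k z U)" by simp
  next
    fix z assume "z \<in> topspace (top_of_set ?sq)"
    then obtain s t where z: "z = (s, t)" "s \<in> {0..1}" "t \<in> {0..1}" by auto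
    obtain W where W: "openin X W" "p t \<in> W" "finite {U. \<exists>y\<in>W. ?m y U \<noteq> 0}"
      by (rule nerve_map_locally_finite[OF pt[OF z(3)]])
    define N where "N = {z \<in> topspace (top_of_set ?sq). (p \<circ> snd) z \<in> W}"
    have "openin (top_of_set ?sq) N"
      unfolding N_def by (rule openin_continuous_map_preimage[OF continuous_map_compose[OF snd contp] W(1)])
    moreover have "z \<in> N" using z W by (auto simp: N_def)
    moreover have "{U. \<exists>y\<in>N. k y U \<noteq> 0} \<subseteq> {U. \<exists>y\<in>W. ?m y U \<noteq> 0}"
    proof
      fix U assume "U \<in> {U. \<exists>y\<in>N. k y U \<noteq> 0}"
      then obtain s' t' where y: "(s', t') \<in> N" "k (s', t') U \<noteq> 0" by auto
      then have "t' \<in> {0..1}" "p t' \<in> W" by (auto simp: N_def)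
      moreover from this have "?m (p t') U \<noteq> 0" using sub[of t' s'] y(2) by blast
      ultimately show "U \<in> {U. \<exists>y\<in>W. ?m y U \<noteq> 0}" by blast
    qed
    then have "finite {U. \<exists>y\<in>N. k y U \<noteq> 0}" using W(3) finite_subset by blast
    ultimately show "\<exists>W. openin (top_of_set ?sq) W \<and> z \<in> W \<and> finite {U. \<exists>y\<in>W. k y U \<noteq> 0}"
      by blast
  next
    fix z assume "z \<in> topspace (top_of_set ?sq)"
    then obtain s t where z: "z = (s, t)" "s \<in> {0..1}" "t \<in> {0..1}" by auto
    let ?S = "{U. ?m (p t) U \<noteq> 0}"
    note S = nerve_map_support[OF pt[OF z(3)]]
    have fin: "finite ?S" using S(1) by (simp add: nerve_def)
    \<comment> \<open>Positivity at \<open>U0\<close> keeps the support nonempty, so that it is a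
      face of the simplex found above.\<close>
    have "k z U0 > 0"
    proof (cases "s = 1")
      case False
      then have "(1 - s) * ?m (p t) U0 > 0" using z mU0[of t] by simp
      then show ?thesis using z by (simp add: k_def vertex_point_def)
    qed (use z in \<open>simp add: k_def vertex_point_def\<close>)
    then have "{U. k z U \<noteq> 0} \<noteq> {}" by force
    then show "{U. k z U \<noteq> 0} \<in> nerve \<U>"
      using nerve_face[OF S(1) sub[OF z(3)]] z(1) by blast
    have U0S: "U0 \<in> ?S" using mU0[OF z(3)] by simp
    have "(\<Sum>U | k z U \<noteq> 0. k z U) = (\<Sum>U\<in>?S. k z U)"
      using sub[OF z(3), of s] fin z(1) by (intro sum.mono_neutral_left) auto
    also have "\<dots> = (1 - s) * (\<Sum>U\<in>?S. ?m (p t) U) + s * (\<Sum>U\<in>?S. vertex_point U0 U)"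
      by (simp add: k_def z(1) sum.distrib sum_distrib_left)
    also have "(\<Sum>U\<in>?S. vertex_point U0 U) = 1"
      using fin U0S unfolding vertex_point_def by (subst sum.delta) auto
    also have "(\<Sum>U\<in>?S. ?m (p t) U) = 1" using S(2) by (simp add: simplex_points_def)
    finally have "(\<Sum>U | k z U \<noteq> 0. k z U) = 1" by simp
    moreover have "0 \<le> k z U" for U
      using z nn[OF z(3)] by (auto simp: k_def vertex_point_def)
    ultimately show "k z \<in> simplex_points {U. k z U \<noteq> 0}" by (simp add: simplex_points_def)
  qed
  moreover have "k (0, t) = (?m \<circ> p) t" "k (1, t) = vertex_point U0" for t
    by (simp_all add: k_def)
  moreover have "?m (p 0) = vertex_point U0" "?m (p 1) = vertex_point U0"
    using nerve_map_basepoint[OF x0] by (simp_all add: ends)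
  then have "k (s, 0) = vertex_point U0" "k (s, 1) = vertex_point U0" for s
    by (simp_all add: k_def algebra_simps)
  ultimately show ?thesis
    unfolding loop_homotopic_iff by (intro exI[of _ k] conjI ballI)
qed

end

section \<open>The loops of the Hawaiian Earring\<close>

lemma continuous_on_earring_loop: "continuous_on S (earring_loop n)"
  unfolding earring_loop_def Complex_eq
  by (intro continuous_intros)

lemma earring_loop_ends [simp]: "earring_loop n 0 = 0" "earring_loop n 1 = 0"
  by (simp_all add: earring_loop_def Complex_eq_0)

text \<open>The affine map \<open>1 - n * z\<close> takes the \<open>n\<close>-th circle to the unit
  circle and the basepoint 0 to 1. The negative exponent records that the loop runs
  clockwise.\<close>

lemma one_minus_earring_loop:
  assumes "n \<ge> 1"
  shows "1 - of_nat n * earring_loop n t = exp (- (2 * pi * t) * \<i>)"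
  using assms by (simp add: complex_eq_iff earring_loop_def Re_exp Im_exp)

lemma earring_loop_image:
  assumes "n \<ge> 1"
  shows "earring_loop n ` {0..1} = sphere (Complex (1 / n) 0) (1 / n)"
proof -
  have eq: "z = earring_loop n t \<longleftrightarrow> 1 - of_nat n * z = exp (- (2 * pi * t) * \<i>)" for z t
    unfolding one_minus_earring_loop[OF assms, symmetric] using assms by simp
  have mem: "z \<in> sphere (Complex (1 / n) 0) (1 / n) \<longleftrightarrow> norm (1 - of_nat n * z) = 1" for z
  proof -
    have "1 - of_nat n * z = of_nat n * (Complex (1 / n) 0 - z)"
      using assms by (simp add: complex_eq_iff algebra_simps)
    then have "norm (1 - of_nat n * z) = n * dist (Complex (1 / n) 0) z"
      by (simp add: norm_mult dist_norm)
    then show ?thesis using assms by (simp add: field_simps)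
  qed
  have "\<exists>t\<in>{0..1}. z = earring_loop n t" if z: "norm (1 - of_nat n * z) = 1" for z
  proof -
    \<comment> \<open>The polar form comes with a counterclockwise angle; conjugation turns it into
      the clockwise parameter.\<close>
    obtain t where t: "0 \<le> t" "t < 2 * pi" "cnj (1 - of_nat n * z) = Complex (cos t) (sin t)"
      using complex_unimodular_polar[of "cnj (1 - of_nat n * z)"] z by (metis complex_mod_cnj)
    have "1 - of_nat n * z = cnj (Complex (cos t) (sin t))"
      using t(3) by (metis complex_cnj_cnj)
    also have "\<dots> = exp (- (2 * pi * (t / (2 * pi))) * \<i>)"
      by (simp add: complex_eq_iff Re_exp Im_exp)
    finally have "z = earring_loop n (t / (2 * pi))" unfolding eq .
    moreover have "t / (2 * pi) \<in> {0..1}" using t by (simp add: field_simps)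
    ultimately show ?thesis by blast
  qed
  moreover have "norm (1 - of_nat n * earring_loop n t) = 1" for t
    unfolding one_minus_earring_loop[OF assms] by (simp add: norm_exp_eq_Re)
  ultimately show ?thesis
    unfolding set_eq_iff mem image_iff by (metis (no_types))
qed

lemma earring_loop_in_earring:
  assumes "n \<ge> 1" "t \<in> {0..1}"
  shows "earring_loop n t \<in> hawaiian_earring"
  using assms earring_loop_image[of n] unfolding hawaiian_earring_def by blast

lemma hawaiian_earring_cases:
  assumes "z \<in> hawaiian_earring"
  obtains n t where "n \<ge> 1" "t \<in> {0..1}" "z = earring_loop n t"
proof -
  obtain n where n: "n \<ge> 1" "z \<in> sphere (Complex (1 / real n) 0) (1 / real n)"
    using assms unfolding hawaiian_earring_def by blast
  then obtain t where "t \<in> {0..1}" "z = earring_loop n t"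
    using earring_loop_image[of n] by blast
  then show ?thesis using that n(1) by simp
qed

lemma norm_earring_loop_le:
  assumes "n \<ge> 1"
  shows "norm (earring_loop n t) \<le> 2 / n"
proof -
  have "of_nat n * earring_loop n t = 1 - exp (- (2 * pi * t) * \<i>)"
    using one_minus_earring_loop[OF assms, of t] by (simp add: algebra_simps)
  then have "n * norm (earring_loop n t) = norm (1 - exp (- (2 * pi * t) * \<i>))"
    by (metis norm_mult norm_of_nat)
  also have "\<dots> \<le> norm (1::complex) + norm (exp (- (2 * pi * t) * \<i>))" by (rule norm_triangle_ineq4)
  also have "\<dots> = 2" by (simp add: norm_exp_eq_Re)
  finally show ?thesis using assms by (simp add: field_simps)
qed

section \<open>Circle-valued maps on the Hawaiian Earring\<close>

lemma sphere_earring_iff: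
  assumes "n \<ge> 1"
  shows "z \<in> sphere (Complex (1 / real n) 0) (1 / real n) \<longleftrightarrow> real n * (norm z)\<^sup>2 = 2 * Re z"
proof -
  have "z \<in> sphere (Complex (1 / real n) 0) (1 / real n) \<longleftrightarrow>
      (norm (z - Complex (1 / real n) 0))\<^sup>2 = (1 / real n)\<^sup>2"
    by (simp add: dist_norm norm_minus_commute power2_eq_iff_nonneg)
  also have "(norm (z - Complex (1 / real n) 0))\<^sup>2 = (norm z)\<^sup>2 - 2 / n * Re z + (1 / real n)\<^sup>2"
    by (simp add: cmod_power2 power2_diff)
  finally show ?thesis using assms by (auto simp: field_simps)
qed

text \<open>On the earring this collapses every circle but the \<open>m\<close>-th to the point 1
  and identifies the \<open>m\<close>-th one with the unit circle.\<close>

definition circle_char :: "nat \<Rightarrow> complex \<Rightarrow> complex" where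
  "circle_char m z =
    (if z \<in> sphere (Complex (1 / real m) 0) (1 / real m) then 1 - of_nat m * z else 1)"

lemma continuous_on_circle_char:
  assumes m: "m \<ge> 1"
  shows "continuous_on hawaiian_earring (circle_char m)"
proof -
  let ?C = "sphere (Complex (1 / real m) 0) (1 / real m)"
  \<comment> \<open>The first set is the closed disk bounded by circle \<open>m + 1\<close>, which
    contains all smaller circles. The second is the complement of the open disk bounded by circle
    \<open>m - 1\<close> (a half-plane if \<open>m = 1\<close>), which contains all larger ones.
    Their union \<open>T\<close> is closed and meets circle \<open>m\<close> in 0 only, where both
    branches have the value 1.\<close>
  define T where "T = {z. (real m + 1) * (norm z)\<^sup>2 \<le> 2 * Re z} \<union> {z. (real m - 1) * (norm z)\<^sup>2 \<ge> 2 * Re z}"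
  have T: "closed T"
    unfolding T_def by (intro closed_Un closed_Collect_le continuous_intros)
  have zero: "z = 0" if z: "z \<in> ?C" "z \<in> T" for z
  proof -
    have "real m * (norm z)\<^sup>2 = 2 * Re z" using z(1) sphere_earring_iff[OF m] by blast
    then have "(norm z)\<^sup>2 \<le> 0" using z(2) by (auto simp: T_def algebra_simps)
    then show ?thesis by simp
  qed
  have "continuous_on (?C \<union> T) (\<lambda>z. if z \<in> ?C then 1 - of_nat m * z else 1)"
    using T zero by (intro continuous_on_cases continuous_intros) auto
  moreover have "hawaiian_earring \<subseteq> ?C \<union> T"
  proof
    fix z assume "z \<in> hawaiian_earring"
    then obtain n where n: "n \<ge> 1" "z \<in> sphere (Complex (1 / real n) 0) (1 / real n)"
      unfolding hawaiian_earring_def by blast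
    then have e: "real n * (norm z)\<^sup>2 = 2 * Re z" using sphere_earring_iff by blast
    consider "n = m" | "n \<ge> m + 1" | "n + 1 \<le> m" by linarith
    then show "z \<in> ?C \<union> T"
    proof cases
      case 1 then show ?thesis using n by simp
    next
      case 2
      then have "(real m + 1) * (norm z)\<^sup>2 \<le> real n * (norm z)\<^sup>2" by (intro mult_right_mono) auto
      then show ?thesis using e by (simp add: T_def)
    next
      case 3
      then have "real n * (norm z)\<^sup>2 \<le> (real m - 1) * (norm z)\<^sup>2" by (intro mult_right_mono) auto
      then show ?thesis using e by (simp add: T_def)
    qed
  qed
  ultimately show ?thesis
    unfolding circle_char_def [abs_def] by (rule continuous_on_subset)
qed

lemma circle_char_earring_loop:
  assumes "n \<ge> 1" "m \<ge> 1" "t \<in> {0..1}"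
  shows "circle_char m (earring_loop n t) = (if n = m then exp (- (2 * pi * t) * \<i>) else 1)"
proof (cases "n = m")
  case True
  have "earring_loop n t \<in> sphere (Complex (1 / real n) 0) (1 / real n)"
    using earring_loop_image[OF assms(1)] assms(3) by blast
  then show ?thesis
    using True one_minus_earring_loop[OF assms(1), of t] by (simp add: circle_char_def)
next
  case False
  let ?z = "earring_loop n t"
  have "real n * (norm ?z)\<^sup>2 = 2 * Re ?z"
    using earring_loop_image[OF assms(1)] assms(3) sphere_earring_iff[OF assms(1)] by blast
  \<comment> \<open>Subtracting the two circle equations shows that distinct circles meet in 0
    only.\<close>
  then have "(real n - real m) * (norm ?z)\<^sup>2 = 0" if "?z \<in> sphere (Complex (1 / real m) 0) (1 / real m)"
    using that unfolding sphere_earring_iff[OF assms(2)] by (simp add: algebra_simps)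
  then have "?z = 0" if "?z \<in> sphere (Complex (1 / real m) 0) (1 / real m)"
    using that False by simp
  then show ?thesis using False by (auto simp: circle_char_def)
qed

text \<open>The value on the \<open>n\<close>-th circle has degree \<open>-1\<close> if \<open>n = 2 ^ j\<close> with \<open>j \<le> J\<close>, and degree \<open>0\<close>
  otherwise. These degrees \<open>w n\<close> satisfy \<open>w n = w (2 * n) + w (2 * n + 1)\<close> for \<open>n < 2 ^ J\<close>, which
  makes the extension over the \<open>n\<close>-th pair of pants possible.\<close>

definition power_char :: "nat \<Rightarrow> complex \<Rightarrow> complex" where
  "power_char J z = (\<Prod>j\<le>J. circle_char (2 ^ j) z)"

lemma continuous_on_power_char: "continuous_on hawaiian_earring (power_char J)"
  unfolding power_char_def [abs_def]
  by (intro continuous_on_prod continuous_on_circle_char) simp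

lemma power_char_earring_loop:
  assumes "n \<ge> 1" "t \<in> {0..1}"
  shows "power_char J (earring_loop n t) =
    (if \<exists>j\<le>J. n = 2 ^ j then exp (- (2 * pi * t) * \<i>) else 1)"
proof -
  let ?e = "exp (- (2 * pi * t) * \<i>)"
  have eq: "power_char J (earring_loop n t) = (\<Prod>j\<le>J. if n = 2 ^ j then ?e else 1)"
    unfolding power_char_def using assms by (intro prod.cong circle_char_earring_loop) auto
  show ?thesis
  proof (cases "\<exists>j\<le>J. n = 2 ^ j")
    case True
    then obtain i where i: "i \<le> J" "n = 2 ^ i" by blast
    \<comment> \<open>Distinct exponents give distinct powers of two, so a single factor differs
      from 1.\<close>
    have "(\<Prod>j\<le>J. if n = 2 ^ j then ?e else 1) = (\<Prod>j\<le>J. if i = j then ?e else 1)"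
      by (intro prod.cong) (auto simp: i)
    also have "\<dots> = ?e" using i by (simp add: prod.delta)
    finally show ?thesis using True eq by simp
  next
    case False
    then have "(\<Prod>j\<le>J. if n = 2 ^ j then ?e else 1) = 1" by (intro prod.neutral) auto
    then show ?thesis unfolding eq if_not_P[OF False] .
  qed
qed

lemma power_char_nonzero:
  assumes "z \<in> hawaiian_earring"
  shows "power_char J z \<noteq> 0"
  using assms by (rule hawaiian_earring_cases) (auto simp: power_char_earring_loop)

section \<open>Functions and logarithms on simple closed curves\<close>

lemma simple_loop_descend:
  fixes a :: "real \<Rightarrow> complex" and \<psi> :: "real \<Rightarrow> complex"
  assumes a: "simple_path a" "pathfinish a = pathstart a"
    and \<psi>: "continuous_on {0..1} \<psi>" "\<psi> 0 = \<psi> 1"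
  obtains \<theta> where "continuous_on (path_image a) \<theta>" "\<And>t. t \<in> {0..1} \<Longrightarrow> \<theta> (a t) = \<psi> t"
proof -
  have "continuous_on {0..1} a" using a(1) by (simp add: simple_path_def path_def)
  \<comment> \<open>By compactness the curve is a quotient of the unit interval, and simplicity
    means that only the end points are identified.\<close>
  then have quo: "quotient_map (top_of_set {0..1}) (top_of_set (path_image a)) a"
    by (intro continuous_imp_quotient_map)
       (auto simp: compact_space_subtopology Hausdorff_space_subtopology path_image_def)
  have c: "continuous_map (top_of_set {0..1}) euclidean \<psi>" using \<psi>(1) by simp
  obtain \<theta> where \<theta>: "continuous_map (top_of_set (path_image a)) euclidean \<theta>"
    "\<And>t. t \<in> topspace (top_of_set {0..1}) \<Longrightarrow> \<theta> (a t) = \<psi> t"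
  proof (rule quotient_map_lift_exists[OF quo c])
    fix s t :: real assume st: "s \<in> topspace (top_of_set {0..1})" "t \<in> topspace (top_of_set {0..1})" "a s = a t"
    then have "s = t \<or> s = 0 \<and> t = 1 \<or> s = 1 \<and> t = 0"
      using a(1) by (auto simp: simple_path_def loop_free_def)
    then show "\<psi> s = \<psi> t" using \<psi>(2) by auto
  qed (rule that)
  show ?thesis by (rule that[of \<theta>]) (use \<theta> in auto)
qed

text \<open>Along the curve, \<open>g\<close> and \<open>z - c\<close> both wind \<open>N\<close>
  times around 0, so their quotient has degree 0 and possesses a continuous logarithm.\<close>

lemma simple_loop_log:
  assumes a: "simple_path a" "pathfinish a = pathstart a" and c: "c \<notin> path_image a"
    and w: "winding_number a c = of_int N"
    and g: "\<And>t. t \<in> {0..1} \<Longrightarrow> g (a t) = exp (of_int N * (2 * pi * t) * \<i>)"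
  obtains \<theta> where "continuous_on (path_image a) \<theta>"
    "\<And>z. z \<in> path_image a \<Longrightarrow> g z = (z - c) * exp (\<theta> z)"
proof -
  obtain q where q: "path q" "pathfinish q - pathstart q = 2 * of_real pi * \<i> * winding_number a c"
      "\<And>t. t \<in> {0..1} \<Longrightarrow> a t = c + exp (q t)"
    using winding_number_as_continuous_log[OF simple_path_imp_path[OF a(1)] c] by metis
  \<comment> \<open>The difference of the two logarithms along the parameter interval. Both grow by
    \<open>2 * pi * N\<close> times the imaginary unit, so the difference closes up and descends to
    the curve.\<close>
  define \<psi> where "\<psi> t = of_int N * (2 * pi * t) * \<i> - q t" for t :: real
  have "continuous_on {0..1} \<psi>"
    using q(1) unfolding \<psi>_def path_def by (intro continuous_intros)
  moreover have "\<psi> 0 = \<psi> 1"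
    using q(2) by (simp add: \<psi>_def w pathfinish_def pathstart_def algebra_simps)
  ultimately obtain \<theta> where \<theta>: "continuous_on (path_image a) \<theta>" "\<And>t. t \<in> {0..1} \<Longrightarrow> \<theta> (a t) = \<psi> t"
    by (rule simple_loop_descend[OF a]) blast
  have "g z = (z - c) * exp (\<theta> z)" if "z \<in> path_image a" for z
  proof -
    obtain t where t: "t \<in> {0..1}" "z = a t" using \<open>z \<in> path_image a\<close> unfolding path_image_def by blast
    have "exp (q t) * exp (\<psi> t) = exp (of_int N * (2 * pi * t) * \<i>)"
      by (simp add: \<psi>_def flip: exp_add)
    then show ?thesis using t q(3)[OF t(1)] g[OF t(1)] \<theta>(2)[OF t(1)] by simp
  qed
  with \<theta>(1) show ?thesis by (rule that)
qed

section \<open>The Hawaiian Pants as a quotient space\<close>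

lemma quotient_map_quotient_topology:
  assumes "equiv (topspace X) R"
  shows "quotient_map X (quotient_topology X R) (\<lambda>x. R `` {x})"
proof -
  have U: "\<Union>(topspace X // R) = topspace X"
    using assms by (rule Union_quotient)
  have top: "topspace (quotient_topology X R) = topspace X // R"
  proof
    show "topspace (quotient_topology X R) \<subseteq> topspace X // R"
      using openin_topspace[of "quotient_topology X R"] openin_quotient_topology[OF assms] by metis
    show "topspace X // R \<subseteq> topspace (quotient_topology X R)"
      by (rule openin_subset) (simp add: openin_quotient_topology[OF assms] U)
  qed
  show ?thesis
    unfolding quotient_map_def top
  proof (intro conjI allI impI)
    show "(\<lambda>x. R `` {x}) ` topspace X = topspace X // R"
      by (auto simp: quotient_def)
    \<comment> \<open>The points of the quotient are the classes themselves, so the preimage of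
      \<open>W\<close> under the projection is the union of its members.\<close>
    fix W assume W: "W \<subseteq> topspace X // R"
    have "{x \<in> topspace X. R `` {x} \<in> W} = \<Union>W"
    proof
      show "{x \<in> topspace X. R `` {x} \<in> W} \<subseteq> \<Union>W"
        using equiv_class_self[OF assms] by blast
      show "\<Union>W \<subseteq> {x \<in> topspace X. R `` {x} \<in> W}"
      proof
        fix x assume "x \<in> \<Union>W"
        then obtain c where c: "c \<in> W" "x \<in> c" by blast
        then have cq: "c \<in> topspace X // R" using W by blast
        then obtain y where y: "y \<in> topspace X" "c = R `` {y}" by (rule quotientE)
        then have "(y, x) \<in> R" using c by blast
        then have "R `` {x} = c" using equiv_class_eq[OF assms] y by simp
        moreover have "x \<in> topspace X" using c cq U by blast
        ultimately show "x \<in> {x \<in> topspace X. R `` {x} \<in> W}" using c by simp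
      qed
    qed
    then show "openin X {x \<in> topspace X. R `` {x} \<in> W} = openin (quotient_topology X R) W"
      using W by (simp add: openin_quotient_topology[OF assms])
  qed
qed

lemma continuous_map_from_sum_topology:
  assumes "\<And>i. i \<in> I \<Longrightarrow> continuous_map (X i) Y (\<lambda>x. g (i, x))"
  shows "continuous_map (sum_topology X I) Y g"
  unfolding continuous_map_def
proof (intro conjI allI impI)
  show "g \<in> topspace (sum_topology X I) \<rightarrow> topspace Y"
    using assms by (fastforce simp: continuous_map_def)
  fix U assume U: "openin Y U"
  have "{x. (i, x) \<in> {x \<in> topspace (sum_topology X I). g x \<in> U}} = {x \<in> topspace (X i). g (i, x) \<in> U}"
    if "i \<in> I" for i using that by auto
  moreover have "openin (X i) {x \<in> topspace (X i). g (i, x) \<in> U}" if "i \<in> I" for i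
    using assms[OF that] U by (rule openin_continuous_map_preimage)
  ultimately show "openin (sum_topology X I) {x \<in> topspace (sum_topology X I). g x \<in> U}"
    unfolding openin_sum_topology by auto
qed

section \<open>The gluing data, the pieces and maps out of the Hawaiian Pants\<close>

locale hawaiian_pants_data =
  fixes D D1 D2 :: "nat \<Rightarrow> complex set"
    and \<alpha> \<beta> \<gamma> :: "nat \<Rightarrow> real \<Rightarrow> complex"
    and f :: "nat \<Rightarrow> complex \<Rightarrow> complex"
  assumes disks: "\<And>n. n \<ge> 1 \<Longrightarrow> closed_disk (D n) \<and> closed_disk (D1 n) \<and> closed_disk (D2 n)"
    and inside: "\<And>n. n \<ge> 1 \<Longrightarrow> D1 n \<subseteq> interior (D n) \<and> D2 n \<subseteq> interior (D n)"
    and disjoint: "\<And>n. n \<ge> 1 \<Longrightarrow> D1 n \<inter> D2 n = {}"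
    and alpha: "\<And>n. n \<ge> 1 \<Longrightarrow> clockwise_boundary (D n) (\<alpha> n)"
    and beta: "\<And>n. n \<ge> 1 \<Longrightarrow> clockwise_boundary (D1 n) (\<beta> n)"
    and gamma: "\<And>n. n \<ge> 1 \<Longrightarrow> clockwise_boundary (D2 n) (\<gamma> n)"
    and f_alpha: "\<And>n t. n \<ge> 1 \<Longrightarrow> t \<in> {0..1} \<Longrightarrow> f n (\<alpha> n t) = earring_loop n t"
    and f_beta: "\<And>n t. n \<ge> 1 \<Longrightarrow> t \<in> {0..1} \<Longrightarrow> f n (\<beta> n t) = earring_loop (2 * n) t"
    and f_gamma: "\<And>n t. n \<ge> 1 \<Longrightarrow> t \<in> {0..1} \<Longrightarrow> f n (\<gamma> n t) = earring_loop (2 * n + 1) t"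
begin

abbreviation "P \<equiv> hawaiian_pants D D1 D2 f"
abbreviation "b0 \<equiv> pants_basepoint D D1 D2 f"

definition piece :: "nat \<Rightarrow> complex set" where
  "piece n = (if n = 0 then hawaiian_earring else pants (D n) (D1 n) (D2 n))"

abbreviation bdry :: "nat \<Rightarrow> complex set" where
  "bdry n \<equiv> pants_boundary (D n) (D1 n) (D2 n)"

definition proj :: "nat \<Rightarrow> complex \<Rightarrow> (nat \<times> complex) set" where
  "proj n z = pants_glue D D1 D2 f `` {(n, z)}"

definition pants_loop :: "nat \<Rightarrow> real \<Rightarrow> (nat \<times> complex) set" where
  "pants_loop n t = proj 0 (earring_loop n t)"

lemma pants_sum_eq: "pants_sum D D1 D2 = sum_topology (\<lambda>n. top_of_set (piece n)) UNIV"
  by (simp add: pants_sum_def piece_def)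

lemma topspace_pants_sum: "topspace (pants_sum D D1 D2) = Sigma UNIV piece"
  by (simp add: pants_sum_eq o_def)

lemma boundary_paths:
  assumes "n \<ge> 1"
  shows "simple_path (\<alpha> n)" "simple_path (\<beta> n)" "simple_path (\<gamma> n)"
    and "pathfinish (\<alpha> n) = pathstart (\<alpha> n)" "pathfinish (\<beta> n) = pathstart (\<beta> n)"
      "pathfinish (\<gamma> n) = pathstart (\<gamma> n)"
    and "path_image (\<alpha> n) = frontier (D n)" "path_image (\<beta> n) = frontier (D1 n)"
      "path_image (\<gamma> n) = frontier (D2 n)"
  using alpha[OF assms] beta[OF assms] gamma[OF assms] by (simp_all add: clockwise_boundary_def)

lemma boundary_cases:
  assumes "n \<ge> 1" "z \<in> bdry n"
  obtains (a) t where "t \<in> {0..1}" "z = \<alpha> n t" | (b) t where "t \<in> {0..1}" "z = \<beta> n t"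
    | (c) t where "t \<in> {0..1}" "z = \<gamma> n t"
proof -
  have "z \<in> \<alpha> n ` {0..1} \<or> z \<in> \<beta> n ` {0..1} \<or> z \<in> \<gamma> n ` {0..1}"
    using boundary_paths(7-9)[OF assms(1)] assms(2) by (auto simp: pants_boundary_def path_image_def)
  then show ?thesis using a b c by blast
qed

lemma boundary_paths_in:
  assumes "n \<ge> 1" "t \<in> {0..1}"
  shows "\<alpha> n t \<in> bdry n" "\<beta> n t \<in> bdry n" "\<gamma> n t \<in> bdry n"
  using boundary_paths(7-9)[OF assms(1)] assms(2) by (auto simp: pants_boundary_def path_image_def)

lemma f_in_earring:
  assumes "n \<ge> 1" "z \<in> bdry n"
  shows "f n z \<in> hawaiian_earring"
  using assms
  by (cases rule: boundary_cases) (use assms in \<open>simp_all add: f_alpha f_beta f_gamma earring_loop_in_earring\<close>)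

lemma boundary_frontiers_disjoint:
  assumes "n \<ge> 1"
  shows "frontier (D n) \<inter> D1 n = {}" "frontier (D n) \<inter> D2 n = {}"
    "frontier (D1 n) \<subseteq> D1 n" "frontier (D2 n) \<subseteq> D2 n"
proof -
  have cl: "closed (D1 n)" "closed (D2 n)" using disks[OF assms] by (auto simp: closed_disk_def)
  show "frontier (D n) \<inter> D1 n = {}" "frontier (D n) \<inter> D2 n = {}"
    using inside[OF assms] by (auto simp: frontier_def)
  show "frontier (D1 n) \<subseteq> D1 n" "frontier (D2 n) \<subseteq> D2 n"
    using cl by (simp_all add: frontier_subset_eq)
qed

lemma bdry_subset_piece:
  assumes n: "n \<ge> 1"
  shows "bdry n \<subseteq> piece n"
proof -
  have cl: "closed (D n)" using disks[OF n] by (auto simp: closed_disk_def)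
  note fr = boundary_frontiers_disjoint[OF n]
  have "frontier (D n) \<subseteq> D n" using cl by (simp add: frontier_subset_eq)
  moreover have "frontier (D1 n) \<inter> interior (D1 n) = {}" "frontier (D2 n) \<inter> interior (D2 n) = {}"
    by (auto simp: frontier_def)
  ultimately show ?thesis
    using fr inside[OF n] disjoint[OF n] interior_subset[of "D n"] interior_subset[of "D1 n"]
      interior_subset[of "D2 n"] n
    unfolding pants_boundary_def piece_def pants_def by auto
qed

lemma closed_bdry: "closed (bdry n)"
  unfolding pants_boundary_def by (intro closed_Un frontier_closed)

lemma proj_glue:
  assumes n: "n \<ge> 1" and z: "z \<in> bdry n"
  shows "proj n z = proj 0 (f n z)"
proof -
  have "((n, z), (0, f n z)) \<in> pants_glue D D1 D2 f"
    unfolding pants_glue_def topspace_pants_sum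
    using n z bdry_subset_piece[OF n] f_in_earring[OF n z]
    by (auto simp: piece_def intro!: r_into_equivclp)
  then show ?thesis
    unfolding proj_def by (rule equiv_class_eq[OF equiv_pants_glue])
qed

lemma quotient_map_pants:
  "quotient_map (pants_sum D D1 D2) P (\<lambda>x. pants_glue D D1 D2 f `` {x})"
  unfolding hawaiian_pants_def by (rule quotient_map_quotient_topology[OF equiv_pants_glue])

lemma continuous_map_proj: "continuous_map (top_of_set (piece n)) P (proj n)"
proof -
  have "continuous_map (top_of_set (piece n)) (pants_sum D D1 D2) (\<lambda>z. (n, z))"
    unfolding pants_sum_eq by (rule continuous_map_component_injection) simp
  from continuous_map_compose[OF this quotient_imp_continuous_map[OF quotient_map_pants]]
  show ?thesis by (simp add: o_def proj_def [abs_def])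
qed

lemma topspace_pants: "x \<in> topspace P \<longleftrightarrow> (\<exists>n. \<exists>z\<in>piece n. x = proj n z)"
proof -
  have "topspace P = (\<lambda>x. pants_glue D D1 D2 f `` {x}) ` Sigma UNIV piece"
    using quotient_imp_surjective_map[OF quotient_map_pants] by (simp add: topspace_pants_sum)
  then show ?thesis by (auto simp: proj_def)
qed

text \<open>The universal property of the adjunction space; all maps out of \<open>P\<close> to
  nontrivial test spaces are built with it.\<close>

lemma pants_map:
  assumes cont: "\<And>n. continuous_map (top_of_set (piece n)) Y (g n)"
    and glue: "\<And>n z. n \<ge> 1 \<Longrightarrow> z \<in> bdry n \<Longrightarrow> g n z = g 0 (f n z)"
  obtains G where "continuous_map P Y G" "\<And>n z. z \<in> piece n \<Longrightarrow> G (proj n z) = g n z"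
proof -
  let ?q = "\<lambda>x. pants_glue D D1 D2 f `` {x}"
  have c: "continuous_map (pants_sum D D1 D2) Y (case_prod g)"
    unfolding pants_sum_eq by (rule continuous_map_from_sum_topology) (simp add: cont)
  have fib: "case_prod g x = case_prod g y"
    if "x \<in> topspace (pants_sum D D1 D2)" "y \<in> topspace (pants_sum D D1 D2)" "?q x = ?q y" for x y
  proof -
    have "(x, y) \<in> pants_glue D D1 D2 f"
      using eq_equiv_class[OF that(3) equiv_pants_glue that(2)] .
    then have "equivclp (\<lambda>x y. \<exists>n\<ge>1. \<exists>z \<in> bdry n. x = (n, z) \<and> y = (0, f n z)) x y"
      by (simp add: pants_glue_def)
    \<comment> \<open>Equivalent points are joined by a finite zigzag of gluing steps, and each step
      preserves the value by \<open>glue\<close>.\<close>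
    then show ?thesis
      by (induction rule: equivclp_induct) (use glue in \<open>auto\<close>)
  qed
  obtain G where G: "continuous_map P Y G"
      "\<And>x. x \<in> topspace (pants_sum D D1 D2) \<Longrightarrow> G (?q x) = case_prod g x"
  proof (rule quotient_map_lift_exists[OF quotient_map_pants c])
    show "case_prod g x = case_prod g y"
      if "x \<in> topspace (pants_sum D D1 D2)" "y \<in> topspace (pants_sum D D1 D2)" "?q x = ?q y" for x y
      using that by (rule fib)
  qed (rule that)
  have "G (proj n z) = g n z" if "z \<in> piece n" for n z
    using G(2)[of "(n, z)"] that by (simp add: topspace_pants_sum proj_def)
  with G(1) show ?thesis by (rule that)
qed

lemma basepoint_eq: "b0 = proj 0 0"
  by (simp add: pants_basepoint_def proj_def)

lemma zero_in_piece: "0 \<in> piece 0"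
  using earring_loop_in_earring[of 1 0] by (simp add: piece_def)

lemma basepoint_in: "b0 \<in> topspace P"
  using zero_in_piece topspace_pants basepoint_eq by blast

lemma earring_loop_in_piece: "n \<ge> 1 \<Longrightarrow> t \<in> {0..1} \<Longrightarrow> earring_loop n t \<in> piece 0"
  by (simp add: piece_def earring_loop_in_earring)

lemma loop_in_pants_loop:
  assumes "n \<ge> 1"
  shows "loop_in P b0 (pants_loop n)"
proof -
  have "continuous_map (top_of_set {0..1}) (top_of_set (piece 0)) (earring_loop n)"
    using earring_loop_in_piece[OF assms] continuous_on_earring_loop
    by (auto simp: continuous_map_in_subtopology)
  from continuous_map_compose[OF this continuous_map_proj[of 0]]
  show ?thesis
    by (simp add: loop_in_def pathin_def o_def pants_loop_def[abs_def] basepoint_eq)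
qed

section \<open>Spreading null-homotopies from small loops to large ones\<close>

lemma pants_loop_null_step:
  assumes n: "n \<ge> 1" and G: "continuous_map P Y G" and y0: "G b0 = y0"
    and null: "loop_homotopic Y y0 (G \<circ> pants_loop (2 * n)) (\<lambda>_. y0)"
      "loop_homotopic Y y0 (G \<circ> pants_loop (2 * n + 1)) (\<lambda>_. y0)"
  shows "loop_homotopic Y y0 (G \<circ> pants_loop n) (\<lambda>_. y0)"
proof -
  \<comment> \<open>In \<open>P\<close> the curves \<open>\<alpha> n\<close>,
    \<open>\<beta> n\<close>, \<open>\<gamma> n\<close> become the loops with indices
    \<open>n\<close>, \<open>2 * n\<close>, \<open>2 * n + 1\<close>, so the disk argument applies
    to \<open>G\<close> on the \<open>n\<close>-th pair of pants.\<close>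
  have G': "continuous_map (top_of_set (pants (D n) (D1 n) (D2 n))) Y (G \<circ> proj n)"
    using continuous_map_compose[OF continuous_map_proj[of n] G] n by (simp add: piece_def)
  note in' = boundary_paths_in[OF n]
  have a: "(G \<circ> proj n \<circ> \<alpha> n) t = (G \<circ> pants_loop n) t" if "t \<in> {0..1}" for t
    using proj_glue[OF n in'(1)[OF that]] f_alpha[OF n that] by (simp add: pants_loop_def)
  have b: "(G \<circ> proj n \<circ> \<beta> n) t = (G \<circ> pants_loop (2 * n)) t" if "t \<in> {0..1}" for t
    using proj_glue[OF n in'(2)[OF that]] f_beta[OF n that] by (simp add: pants_loop_def)
  have c: "(G \<circ> proj n \<circ> \<gamma> n) t = (G \<circ> pants_loop (2 * n + 1)) t" if "t \<in> {0..1}" for t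
    using proj_glue[OF n in'(3)[OF that]] f_gamma[OF n that] by (simp add: pants_loop_def)
  have "loop_homotopic Y y0 (G \<circ> proj n \<circ> \<alpha> n) (\<lambda>_. y0)"
  proof (rule pants_boundary_null[of "D n" "D1 n" "D2 n" "\<alpha> n" "\<beta> n" "\<gamma> n"])
    show "(G \<circ> proj n) (\<alpha> n 0) = y0"
      using a[of 0] by (simp add: pants_loop_def basepoint_eq flip: y0)
    show "loop_homotopic Y y0 (G \<circ> proj n \<circ> \<beta> n) (\<lambda>_. y0)"
      using null(1) b by (rule loop_homotopic_eq)
    show "loop_homotopic Y y0 (G \<circ> proj n \<circ> \<gamma> n) (\<lambda>_. y0)"
      using null(2) c by (rule loop_homotopic_eq)
  qed (use disks[OF n] inside[OF n] disjoint[OF n] alpha[OF n] beta[OF n] gamma[OF n] G' in auto)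
  then show ?thesis by (rule loop_homotopic_eq) (rule a[symmetric])
qed

text \<open>The \<open>n\<close>-th circle lies within distance \<open>2 / n\<close> of the
  basepoint, hence eventually inside the preimage of \<open>W\<close> in the earring.\<close>

lemma pants_loops_small:
  assumes W: "openin P W" "b0 \<in> W"
  obtains M where "M \<ge> 1" "\<And>n t. n \<ge> M \<Longrightarrow> t \<in> {0..1} \<Longrightarrow> pants_loop n t \<in> W"
proof -
  have "openin (top_of_set (piece 0)) {z \<in> topspace (top_of_set (piece 0)). proj 0 z \<in> W}"
    using continuous_map_proj W(1) by (rule openin_continuous_map_preimage)
  then obtain e where e: "e > 0" "\<And>z. z \<in> piece 0 \<Longrightarrow> dist z 0 < e \<Longrightarrow> proj 0 z \<in> W"
    using zero_in_piece W(2) unfolding openin_euclidean_subtopology_iff basepoint_eq by force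
  obtain M :: nat where M: "M > 2 / e" using reals_Archimedean2 by blast
  show ?thesis
  proof
    show "Suc M \<ge> 1" by simp
    fix n t assume n: "n \<ge> Suc M" and t: "t \<in> {0..1::real}"
    have "norm (earring_loop n t) \<le> 2 / n" using n by (intro norm_earring_loop_le) simp
    also have "\<dots> < e"
    proof -
      have "2 / e < n" using M n by linarith
      then show ?thesis using e n by (simp add: field_simps)
    qed
    finally show "pants_loop n t \<in> W"
      using e(2)[OF earring_loop_in_piece] n t by (simp add: pants_loop_def)
  qed
qed

text \<open>Both \<open>2 * n\<close> and \<open>2 * n + 1\<close> exceed \<open>n\<close> when
  \<open>n \<ge> 1\<close>, so for \<open>n < M\<close> the distance \<open>M - n\<close> strictly
  decreases in the recursion.\<close>

lemma pants_loop_null_all: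
  assumes G: "continuous_map P Y G" and y0: "G b0 = y0"
    and large: "\<And>n. n \<ge> M \<Longrightarrow> loop_homotopic Y y0 (G \<circ> pants_loop n) (\<lambda>_. y0)"
    and n: "n \<ge> 1"
  shows "loop_homotopic Y y0 (G \<circ> pants_loop n) (\<lambda>_. y0)"
  using n
proof (induction "M - n" arbitrary: n rule: less_induct)
  case less
  show ?case
  proof (cases "n \<ge> M")
    case False
    have "loop_homotopic Y y0 (G \<circ> pants_loop (2 * n)) (\<lambda>_. y0)"
      by (rule less.hyps) (use False less.prems in linarith)+
    moreover have "loop_homotopic Y y0 (G \<circ> pants_loop (2 * n + 1)) (\<lambda>_. y0)"
      by (rule less.hyps) (use False less.prems in linarith)+
    ultimately show ?thesis
      using pants_loop_null_step[OF less.prems G y0] by simp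
  qed (rule large)
qed

subsection \<open>Essentiality of the first loop\<close>

lemma continuous_on_bdry:
  assumes n: "n \<ge> 1"
    and "continuous_on (frontier (D n)) g" "continuous_on (frontier (D1 n)) g" "continuous_on (frontier (D2 n)) g"
  shows "continuous_on (bdry n) g"
  using assms unfolding pants_boundary_def by (intro continuous_on_closed_Un closed_Un frontier_closed)

text \<open>Continuity of \<open>h\<close> after \<open>f n\<close> on a boundary curve is recovered
  from the parametrization: the composite with the parameter is continuous and closed, so it
  descends to the curve.\<close>

lemma continuous_on_boundary_path:
  assumes a: "simple_path a" "pathfinish a = pathstart a"
    and h: "continuous_on hawaiian_earring h" and m: "m \<ge> 1"
    and f: "\<And>t. t \<in> {0..1} \<Longrightarrow> f n (a t) = earring_loop m t"
  shows "continuous_on (path_image a) (\<lambda>z. h (f n z) :: complex)"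
proof -
  have "continuous_on {0..1} (\<lambda>t. h (earring_loop m t))"
    using earring_loop_in_earring[OF m]
    by (intro continuous_on_compose2[OF h continuous_on_earring_loop]) auto
  then obtain \<theta> where \<theta>: "continuous_on (path_image a) \<theta>"
      "\<And>t. t \<in> {0..1} \<Longrightarrow> \<theta> (a t) = h (earring_loop m t)"
    by (rule simple_loop_descend[OF a]) auto
  show ?thesis
  proof (rule continuous_on_eq[OF \<theta>(1)])
    fix z assume "z \<in> path_image a"
    then obtain t where "t \<in> {0..1}" "z = a t" unfolding path_image_def by blast
    then show "\<theta> z = h (f n z)" using \<theta>(2) f by simp
  qed
qed

lemma continuous_on_bdry_f:
  assumes n: "n \<ge> 1" and h: "continuous_on hawaiian_earring h"
  shows "continuous_on (bdry n) (\<lambda>z. h (f n z) :: complex)"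
proof (rule continuous_on_bdry[OF n])
  note b = boundary_paths[OF n]
  show "continuous_on (frontier (D n)) (\<lambda>z. h (f n z))"
    using continuous_on_boundary_path[OF b(1,4) h n f_alpha[OF n]] b(7) by simp
  show "continuous_on (frontier (D1 n)) (\<lambda>z. h (f n z))"
    using continuous_on_boundary_path[OF b(2,5) h _ f_beta[OF n]] b(8) n by simp
  show "continuous_on (frontier (D2 n)) (\<lambda>z. h (f n z))"
    using continuous_on_boundary_path[OF b(3,6) h _ f_gamma[OF n]] b(9) by simp
qed

text \<open>Tietze extension gives no control over zeros. It is therefore applied to logarithms
  where a nonvanishing extension is wanted, and to the function itself on the other pairs of
  pants.\<close>

lemma bdry_extend:
  assumes n: "n \<ge> 1" and g: "continuous_on (bdry n) (g :: complex \<Rightarrow> complex)"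
  obtains G where "continuous_on (piece n) G" "\<And>z. z \<in> bdry n \<Longrightarrow> G z = g z"
proof (rule Tietze_unbounded[OF g])
  show "closedin (top_of_set (piece n)) (bdry n)"
    using closed_bdry bdry_subset_piece[OF n] by (simp add: closed_subset)
qed (rule that)

text \<open>If \<open>n\<close> is not a power of two, the boundary values are constantly 1. If it
  is, they have degree -1 on the outer boundary and on the first inner one, and degree 0 on the
  second; so does \<open>z - c1\<close> with \<open>c1\<close> the centre of the first hole. The two
  functions then differ by an exponential, whose exponent extends.\<close>

lemma power_char_extend_nonzero:
  assumes n: "n \<ge> 1" "n < 2 ^ J"
  obtains g where "continuous_on (piece n) g" "\<And>z. z \<in> bdry n \<Longrightarrow> g z = power_char J (f n z)"
    "\<And>z. z \<in> piece n \<Longrightarrow> g z \<noteq> 0"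
proof -
  let ?h = "\<lambda>z. power_char J (f n z)"
  \<comment> \<open>Since \<open>n \<ge> 1\<close>, the number is odd and at least 3.\<close>
  have odd: "2 * n + 1 \<noteq> 2 ^ j" for j
    using n(1) by (cases j) (auto, presburger)
  have c: "?h (\<gamma> n t) = 1" if "t \<in> {0..1}" for t
    using power_char_earring_loop[of "2 * n + 1" t J] f_gamma[OF n(1) that] that odd by simp
  show ?thesis
  proof (cases "\<exists>j. n = 2 ^ j")
    case False
    have ev: "2 * n \<noteq> 2 ^ j" for j
      using n(1) False by (cases j) auto
    have "?h (\<beta> n t) = 1" "?h (\<alpha> n t) = 1" if "t \<in> {0..1}" for t
      using power_char_earring_loop[of "2 * n" t J] f_beta[OF n(1) that]
        power_char_earring_loop[of n t J] f_alpha[OF n(1) that] that ev n(1) False by auto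
    then have "1 = ?h z" if "z \<in> bdry n" for z
      using boundary_cases[OF n(1) that] c by metis
    then show ?thesis by (intro that[of "\<lambda>_. 1"]) auto
  next
    case True
    then obtain i where i: "n = 2 ^ i" by blast
    \<comment> \<open>Strictness matters: the exponent \<open>Suc i\<close> of \<open>2 * n\<close>
      must still be at most \<open>J\<close>.\<close>
    then have iJ: "i < J" using n(2) by simp
    have a: "?h (\<alpha> n t) = exp (of_int (- 1) * (2 * pi * t) * \<i>)" if "t \<in> {0..1}" for t
    proof -
      have "\<exists>j\<le>J. n = 2 ^ j" using i iJ by (intro exI[of _ i]) simp
      then show ?thesis using power_char_earring_loop[OF n(1) that, of J] f_alpha[OF n(1) that] by simp
    qed
    have b: "?h (\<beta> n t) = exp (of_int (- 1) * (2 * pi * t) * \<i>)" if "t \<in> {0..1}" for t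
    proof -
      have "\<exists>j\<le>J. 2 * n = 2 ^ j" using i iJ by (intro exI[of _ "Suc i"]) simp
      then show ?thesis
        using power_char_earring_loop[of "2 * n" t J] f_beta[OF n(1) that] n(1) that by simp
    qed
    have c': "?h (\<gamma> n t) = exp (of_int 0 * (2 * pi * t) * \<i>)" if "t \<in> {0..1}" for t
      using c that by simp
    \<comment> \<open>The centre of the first hole lies outside the pants, so \<open>z - c1\<close>
      has no zero there.\<close>
    obtain c1 r1 where D1: "D1 n = cball c1 r1" "0 < r1"
      using disks[OF n(1)] by (auto simp: closed_disk_def)
    obtain c2 r2 where D2: "D2 n = cball c2 r2" "0 < r2"
      using disks[OF n(1)] by (auto simp: closed_disk_def)
    have int: "c1 \<in> interior (D1 n)" "c1 \<in> D1 n" using D1 by auto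
    then have intD: "c1 \<in> interior (D n)" using inside[OF n(1)] by blast
    have out: "c1 \<notin> D2 n" using int disjoint[OF n(1)] by blast
    note p = boundary_paths[OF n(1)]
    note fr = boundary_frontiers_disjoint[OF n(1)]
    have wa: "winding_number (\<alpha> n) c1 = of_int (- 1)"
      using alpha[OF n(1)] intD by (simp add: clockwise_boundary_def)
    have wb: "winding_number (\<beta> n) c1 = of_int (- 1)"
      using beta[OF n(1)] int by (simp add: clockwise_boundary_def)
    have wc: "winding_number (\<gamma> n) c1 = of_int 0"
      using winding_number_zero_outside[OF simple_path_imp_path[OF p(3)], of "D2 n" c1] p(6,9) fr(4) D2 out
      by simp
    have na: "c1 \<notin> path_image (\<alpha> n)" using intD p(7) by (simp add: frontier_def)
    have nb: "c1 \<notin> path_image (\<beta> n)" using int p(8) by (simp add: frontier_def)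
    have nc: "c1 \<notin> path_image (\<gamma> n)" using out p(9) fr(4) by blast
    obtain \<theta>a where ta: "continuous_on (frontier (D n)) \<theta>a"
        "\<And>z. z \<in> frontier (D n) \<Longrightarrow> ?h z = (z - c1) * exp (\<theta>a z)"
      using simple_loop_log[OF p(1,4) na wa, of ?h] a p(7) by auto
    obtain \<theta>b where tb: "continuous_on (frontier (D1 n)) \<theta>b"
        "\<And>z. z \<in> frontier (D1 n) \<Longrightarrow> ?h z = (z - c1) * exp (\<theta>b z)"
      using simple_loop_log[OF p(2,5) nb wb, of ?h] b p(8) by auto
    obtain \<theta>c where tc: "continuous_on (frontier (D2 n)) \<theta>c"
        "\<And>z. z \<in> frontier (D2 n) \<Longrightarrow> ?h z = (z - c1) * exp (\<theta>c z)"
      using simple_loop_log[OF p(3,6) nc wc, of ?h] c' p(9) by auto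
    define \<theta> where "\<theta> z = (if z \<in> frontier (D n) then \<theta>a z else if z \<in> frontier (D1 n) then \<theta>b z else \<theta>c z)" for z
    have dis: "frontier (D n) \<inter> frontier (D1 n) = {}" "frontier (D n) \<inter> frontier (D2 n) = {}"
        "frontier (D1 n) \<inter> frontier (D2 n) = {}"
      using fr disjoint[OF n(1)] by blast+
    have "continuous_on (bdry n) \<theta>"
    proof (rule continuous_on_bdry[OF n(1)])
      show "continuous_on (frontier (D n)) \<theta>"
        by (rule continuous_on_eq[OF ta(1)]) (simp add: \<theta>_def)
      show "continuous_on (frontier (D1 n)) \<theta>"
        by (rule continuous_on_eq[OF tb(1)]) (use dis in \<open>auto simp: \<theta>_def\<close>)
      show "continuous_on (frontier (D2 n)) \<theta>"
        by (rule continuous_on_eq[OF tc(1)]) (use dis in \<open>auto simp: \<theta>_def\<close>)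
    qed
    \<comment> \<open>The logarithms on the three disjoint boundary curves are extended jointly;
      exponentiating afterwards creates no zeros.\<close>
    then obtain \<Theta> where T: "continuous_on (piece n) \<Theta>" "\<And>z. z \<in> bdry n \<Longrightarrow> \<Theta> z = \<theta> z"
      by (rule bdry_extend[OF n(1)]) blast
    show ?thesis
    proof (rule that[of "\<lambda>z. (z - c1) * exp (\<Theta> z)"])
      show "continuous_on (piece n) (\<lambda>z. (z - c1) * exp (\<Theta> z))"
        using T(1) by (intro continuous_intros)
      show "(z - c1) * exp (\<Theta> z) = ?h z" if "z \<in> bdry n" for z
        using that T(2)[OF that] ta(2)[of z] tb(2)[of z] tc(2)[of z]
        by (auto simp: \<theta>_def pants_boundary_def)
      show "(z - c1) * exp (\<Theta> z) \<noteq> 0" if "z \<in> piece n" for z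
        using that int n(1) by (auto simp: piece_def pants_def)
    qed
  qed
qed

lemma power_char_extend:
  assumes "n \<ge> 1"
  obtains g where "continuous_on (piece n) g" "\<And>z. z \<in> bdry n \<Longrightarrow> g z = power_char J (f n z)"
    "\<And>z. n < 2 ^ J \<Longrightarrow> z \<in> piece n \<Longrightarrow> g z \<noteq> 0"
proof (cases "n < 2 ^ J")
  case True
  show ?thesis by (rule power_char_extend_nonzero[OF assms True]) (rule that)
next
  case False
  then show ?thesis
    using bdry_extend[OF assms continuous_on_bdry_f[OF assms continuous_on_power_char[of J]]] that
    by (metis (no_types, lifting))
qed

text \<open>A function on \<open>P\<close> that is unbounded along points chosen in the interiors of the pants that are
  met by \<open>k\<close> replaces the argument that a compact subset of \<open>P\<close> meets only finitely many of them.\<close>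

lemma compact_meets_finitely_many_pants:
  assumes k: "continuous_map (top_of_set S) P k" and S: "compact S"
  obtains N where "\<And>n z. N < n \<Longrightarrow> z \<in> piece n \<Longrightarrow> proj n z \<in> k ` S \<Longrightarrow> z \<in> bdry n"
proof -
  define A where "A = {n. n \<ge> 1 \<and> (\<exists>z\<in>piece n. proj n z \<in> k ` S \<and> z \<notin> bdry n)}"
  have "\<forall>n\<in>A. \<exists>z. z \<in> piece n \<and> proj n z \<in> k ` S \<and> z \<notin> bdry n"
    unfolding A_def by blast
  then obtain x where x: "\<And>n. n \<in> A \<Longrightarrow> x n \<in> piece n \<and> proj n (x n) \<in> k ` S \<and> x n \<notin> bdry n"
    by (rule bchoice[THEN exE]) blast
  \<comment> \<open>Normalized so that the value at the chosen point \<open>x n\<close> is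
    \<open>n\<close>. It vanishes on the boundary and hence fits the value 0 on the earring.\<close>
  define \<rho> where "\<rho> n z = (if n \<in> A then n * infdist z (bdry n) / infdist (x n) (bdry n) else 0)"
    for n :: nat and z
  have ne: "bdry n \<noteq> {}" if "n \<in> A" for n
    using boundary_paths_in(1)[of n 0] that by (auto simp: A_def)
  have pos: "infdist (x n) (bdry n) > 0" if "n \<in> A" for n
    using closed_bdry ne[OF that] x[OF that] by (intro infdist_pos_not_in_closed) auto
  obtain R where R: "continuous_map P euclideanreal R" "\<And>n z. z \<in> piece n \<Longrightarrow> R (proj n z) = \<rho> n z"
  proof (rule pants_map[of euclideanreal \<rho>])
    show "continuous_map (top_of_set (piece n)) euclideanreal (\<rho> n)" for n
    proof (cases "n \<in> A")
      case True
      have "continuous_on (piece n) (\<rho> n)"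
        unfolding \<rho>_def using pos[OF True] by (simp add: True) (intro continuous_intros, auto)
      then show ?thesis by simp
    qed (simp add: \<rho>_def[abs_def])
    show "\<rho> n z = \<rho> 0 (f n z)" if "n \<ge> 1" "z \<in> bdry n" for n z
      using that by (simp add: \<rho>_def A_def)
  qed (rule that)
  have "continuous_on S (R \<circ> k)"
    using continuous_map_compose[OF k R(1)] by simp
  then have "bounded ((R \<circ> k) ` S)"
    using S compact_continuous_image compact_imp_bounded by blast
  then obtain B where B: "\<And>s. s \<in> S \<Longrightarrow> \<bar>R (k s)\<bar> \<le> B"
    unfolding bounded_iff by auto
  obtain N :: nat where N: "B \<le> N" using real_arch_simple by blast
  have le: "n \<le> N" if n: "n \<in> A" for n
  proof -
    have "R (proj n (x n)) = n" using R(2)[of "x n" n] x[OF n] pos[OF n] n by (simp add: \<rho>_def)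
    moreover obtain s where "s \<in> S" "proj n (x n) = k s" using x[OF n] by blast
    ultimately have "real n \<le> B" using B[of s] by simp
    then show ?thesis using N by linarith
  qed
  show ?thesis
  proof (rule that[of N])
    fix n z assume n: "N < n" "z \<in> piece n" "proj n z \<in> k ` S"
    show "z \<in> bdry n"
    proof (rule ccontr)
      assume "z \<notin> bdry n"
      then have "n \<in> A" using n unfolding A_def by auto
      then show False using le n(1) by fastforce
    qed
  qed
qed

lemma pants_loop_1_not_null: "\<not> loop_homotopic P b0 (pants_loop 1) (\<lambda>_. b0)"
proof
  let ?sq = "{0..1} \<times> {0..1} :: (real \<times> real) set"
  assume "loop_homotopic P b0 (pants_loop 1) (\<lambda>_. b0)"
  then obtain k where k: "continuous_map (top_of_set ?sq) P k"
    "\<And>t. t \<in> {0..1} \<Longrightarrow> k (0, t) = pants_loop 1 t" "\<And>t. t \<in> {0..1} \<Longrightarrow> k (1, t) = b0"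
    "\<And>s. s \<in> {0..1} \<Longrightarrow> k (s, 0) = b0" "\<And>s. s \<in> {0..1} \<Longrightarrow> k (s, 1) = b0"
    by (rule loop_homotopicE) blast
  obtain J where J: "\<And>n z. J < n \<Longrightarrow> z \<in> piece n \<Longrightarrow> proj n z \<in> k ` ?sq \<Longrightarrow> z \<in> bdry n"
    by (rule compact_meets_finitely_many_pants[OF k(1)]) (auto intro: compact_Times)
  \<comment> \<open>One family for all pieces: index 0 carries \<open>power_char J\<close> itself,
    and every other index an extension that may vanish only if \<open>n \<ge> 2 ^ J\<close>.\<close>
  have "\<forall>n. \<exists>g. continuous_on (piece n) g \<and> (n \<ge> 1 \<longrightarrow> (\<forall>z\<in>bdry n. g z = power_char J (f n z)) \<and>
      (n < 2 ^ J \<longrightarrow> (\<forall>z\<in>piece n. g z \<noteq> 0))) \<and> (n = 0 \<longrightarrow> g = power_char J)"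
  proof
    fix n
    show "\<exists>g. continuous_on (piece n) g \<and> (n \<ge> 1 \<longrightarrow> (\<forall>z\<in>bdry n. g z = power_char J (f n z)) \<and>
      (n < 2 ^ J \<longrightarrow> (\<forall>z\<in>piece n. g z \<noteq> 0))) \<and> (n = 0 \<longrightarrow> g = power_char J)"
    proof (cases "n = 0")
      case True
      then show ?thesis using continuous_on_power_char by (simp add: piece_def)
    next
      case False
      then have "n \<ge> 1" by simp
      then obtain g where "continuous_on (piece n) g" "\<And>z. z \<in> bdry n \<Longrightarrow> g z = power_char J (f n z)"
        "\<And>z. n < 2 ^ J \<Longrightarrow> z \<in> piece n \<Longrightarrow> g z \<noteq> 0"
        by (rule power_char_extend[where J = J]) blast
      then show ?thesis using False by (intro exI[of _ g]) auto
    qed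
  qed
  then obtain g where g: "\<And>n. continuous_on (piece n) (g n)"
      "\<And>n z. n \<ge> 1 \<Longrightarrow> z \<in> bdry n \<Longrightarrow> g n z = power_char J (f n z)"
      "\<And>n z. n \<ge> 1 \<Longrightarrow> n < 2 ^ J \<Longrightarrow> z \<in> piece n \<Longrightarrow> g n z \<noteq> 0" "g 0 = power_char J"
    by (rule choice[THEN exE]) blast
  obtain F where F: "continuous_map P euclidean F" "\<And>n z. z \<in> piece n \<Longrightarrow> F (proj n z) = g n z"
  proof (rule pants_map[of euclidean g])
    show "continuous_map (top_of_set (piece n)) euclidean (g n)" for n using g(1) by simp
    show "g n z = g 0 (f n z)" if "n \<ge> 1" "z \<in> bdry n" for n z using that g(2,4) by simp
  qed (rule that)
  have cont: "continuous_on ?sq (F \<circ> k)"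
    using continuous_map_compose[OF k(1) F(1)] by simp
  have nz: "F (k s) \<noteq> 0" if s: "s \<in> ?sq" for s
  proof -
    have "k s \<in> topspace P" using continuous_map_image_subset_topspace[OF k(1)] s by auto
    then obtain n z where z: "z \<in> piece n" "k s = proj n z" using topspace_pants by blast
    have "g n z \<noteq> 0"
    proof (cases "n = 0")
      case True
      then show ?thesis using z g(4) power_char_nonzero by (simp add: piece_def)
    next
      case False
      show ?thesis
      proof (cases "n < 2 ^ J")
        case True
        then show ?thesis using g(3) False z by simp
      next
        case ge: False
        \<comment> \<open>Thus pants on which the extension may vanish have an index beyond
          \<open>J\<close>, and the homotopy meets them in their boundary only, where the value is
          one of \<open>power_char J\<close> and hence nonzero.\<close>
        have "J < 2 ^ J" by (rule less_exp)
        then have "J < n" using ge by linarith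
        moreover have "proj n z \<in> k ` ?sq" using s by (rule rev_image_eqI) (simp add: z(2))
        ultimately have "z \<in> bdry n" using z(1) by (intro J)
        then show ?thesis
          using g(2) False power_char_nonzero f_in_earring by simp
      qed
    qed
    then show ?thesis using F(2) z by simp
  qed
  \<comment> \<open>As \<open>1 = 2 ^ 0\<close>, the first loop becomes the unit circle traversed
    clockwise.\<close>
  have start: "F (k (0, t)) = reversepath (circlepath 0 1) t" if t: "t \<in> {0..1}" for t
  proof -
    have "F (k (0, t)) = power_char J (earring_loop 1 t)"
      using k(2)[OF t] F(2)[of "earring_loop 1 t" 0] earring_loop_in_piece[of 1 t] t g(4)
      by (simp add: pants_loop_def)
    also have "\<dots> = exp (- (2 * pi * t) * \<i>)"
    proof -
      have "\<exists>j\<le>J. (1::nat) = 2 ^ j" by (intro exI[of _ 0]) simp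
      then show ?thesis using power_char_earring_loop[of 1 t J] t by simp
    qed
    also have "\<dots> = exp (2 * of_real pi * \<i> * of_real (1 - t))"
      using exp_two_pi_i by (simp add: exp_diff exp_minus algebra_simps inverse_eq_divide)
    finally show ?thesis by (simp add: reversepath_def circlepath)
  qed
  have b0: "F b0 = 1"
    using F(2)[OF zero_in_piece] g(4) power_char_earring_loop[of 1 0 J] by (simp add: basepoint_eq)
  \<comment> \<open>Forgetting the basepoint leaves a free homotopy in the punctured plane from a
    loop of winding number -1 to a constant.\<close>
  have "homotopic_loops (- {0}) (reversepath (circlepath 0 1)) (\<lambda>_. 1)"
    unfolding homotopic_loops
  proof (intro exI[of _ "F \<circ> k"] conjI ballI)
    show "F \<circ> k \<in> ?sq \<rightarrow> - {0}" using nz by auto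
    show "(F \<circ> k) (0, t) = reversepath (circlepath 0 1) t" if "t \<in> {0..1}" for t
      using start that by simp
    show "(F \<circ> k) (1, t) = 1" if "t \<in> {0..1}" for t using k(3)[OF that] b0 by simp
    show "pathfinish ((F \<circ> k) \<circ> Pair s) = pathstart ((F \<circ> k) \<circ> Pair s)" if "s \<in> {0..1}" for s
      using k(4,5)[OF that] by (simp add: pathfinish_def pathstart_def)
  qed (rule cont)
  then have "winding_number (reversepath (circlepath 0 1)) 0 = winding_number (\<lambda>_. 1) 0"
    by (rule winding_number_homotopic_loops)
  moreover have "winding_number (reversepath (circlepath 0 1)) 0 = - 1"
    by (subst winding_number_reversepath) (auto simp: winding_number_circlepath_centre)
  moreover have "winding_number (\<lambda>_. 1) 0 = 0"
    by (rule winding_number_zero_const) simp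
  ultimately show False by simp
qed

subsection \<open>Triviality in the first Cech homotopy group\<close>

text \<open>The partition of unity is arbitrary here, so the result applies to whichever one
  \<open>chosen_partition\<close> picks.\<close>

lemma pants_loop_null_in_nerve:
  assumes i: "(\<U>, U0) \<in> pointed_covers P b0" and pou: "pointed_partition_of_unity P b0 \<U> U0 \<phi>"
    and n: "n \<ge> 1"
  shows "loop_homotopic (realization (nerve \<U>)) (vertex_point U0)
    (nerve_map \<U> \<phi> \<circ> pants_loop n) (\<lambda>_. vertex_point U0)"
proof -
  have U0: "U0 \<in> \<U>" using i by (simp add: pointed_covers_def)
  have one: "\<phi> U0 b0 = 1" and c: "continuous_map P euclideanreal (\<phi> U0)"
    using pou U0 by (auto simp: pointed_partition_of_unity_def)
  \<comment> \<open>The preimage of the open star of the base vertex under the nerve map.\<close>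
  define W where "W = {x \<in> topspace P. \<phi> U0 x \<in> {0<..}}"
  have "openin P W"
    unfolding W_def by (rule openin_continuous_map_preimage[OF c]) simp
  moreover have "b0 \<in> W" using basepoint_in one by (simp add: W_def)
  ultimately obtain M where M: "M \<ge> 1" "\<And>n t. n \<ge> M \<Longrightarrow> t \<in> {0..1} \<Longrightarrow> pants_loop n t \<in> W"
    by (rule pants_loops_small) blast
  show ?thesis
  proof (rule pants_loop_null_all[OF continuous_map_nerve_map[OF pou U0] nerve_map_basepoint[OF pou U0 basepoint_in] _ n])
    fix m assume m: "m \<ge> M"
    then have "m \<ge> 1" using M(1) by simp
    then have "loop_in P b0 (pants_loop m)" by (rule loop_in_pants_loop)
    then show "loop_homotopic (realization (nerve \<U>)) (vertex_point U0)
        (nerve_map \<U> \<phi> \<circ> pants_loop m) (\<lambda>_. vertex_point U0)"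
      using M(2)[OF m] by (intro nerve_map_star_null[OF pou U0 _ _ basepoint_in])
        (auto simp: loop_in_def W_def)
  qed
qed

text \<open>\<open>induced_hom\<close> is a union over all representatives. Continuity of the nerve
  map carries the hypothesis from \<open>p\<close> to every other loop in its class, so each member
  of the union is the same trivial class.\<close>

lemma cech_hom_null:
  assumes p: "loop_in P b0 p" and null: "\<And>\<U> U0 \<phi>. (\<U>, U0) \<in> pointed_covers P b0 \<Longrightarrow>
      pointed_partition_of_unity P b0 \<U> U0 \<phi> \<Longrightarrow>
      loop_homotopic (realization (nerve \<U>)) (vertex_point U0) (nerve_map \<U> \<phi> \<circ> p) (\<lambda>_. vertex_point U0)"
  shows "cech_hom P b0 (loop_class P b0 p) =
    (\<lambda>i\<in>pointed_covers P b0. loop_class (nerve_space i) (nerve_point i) (\<lambda>_. nerve_point i))"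
  unfolding cech_hom_def
proof (rule restrict_ext)
  fix i assume i: "i \<in> pointed_covers P b0"
  obtain \<U> U0 where iU: "i = (\<U>, U0)" by (cases i)
  define \<phi> where "\<phi> = chosen_partition P b0 i"
  have ex: "\<exists>\<phi>. pointed_partition_of_unity P b0 \<U> U0 \<phi>" and U0: "U0 \<in> \<U>"
    using i unfolding iU pointed_covers_def by auto
  have pou: "pointed_partition_of_unity P b0 \<U> U0 \<phi>"
    unfolding \<phi>_def chosen_partition_def iU fst_conv snd_conv using ex by (rule someI_ex)
  let ?Y = "realization (nerve \<U>)" and ?m = "nerve_map \<U> \<phi>"
  let ?v = "vertex_point U0"
  have "loop_class ?Y ?v (?m \<circ> q) = loop_class ?Y ?v (\<lambda>_. ?v)" if "q \<in> loop_class P b0 p" for q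
  proof -
    have pq: "loop_homotopic P b0 p q" using that by (simp add: loop_class_def)
    have "loop_homotopic ?Y ?v (?m \<circ> p) (?m \<circ> q)"
      using loop_homotopic_compose[OF pq continuous_map_nerve_map[OF pou U0]]
      by (simp add: nerve_map_basepoint[OF pou U0 basepoint_in])
    then have "loop_homotopic ?Y ?v (?m \<circ> q) (\<lambda>_. ?v)"
      by (rule loop_homotopic_trans[OF loop_homotopic_sym null[OF i[unfolded iU] pou]])
    then show ?thesis by (rule loop_class_eq)
  qed
  moreover have "p \<in> loop_class P b0 p" using loop_homotopic_refl[OF p] by (simp add: loop_class_def)
  ultimately have "(\<Union>q\<in>loop_class P b0 p. loop_class ?Y ?v (?m \<circ> q)) = loop_class ?Y ?v (\<lambda>_. ?v)"
    by (intro UN_constant_eq ballI)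
  then show "induced_hom (nerve_space i) (nerve_point i) (nerve_map (fst i) (chosen_partition P b0 i))
      (loop_class P b0 p) = loop_class (nerve_space i) (nerve_point i) (\<lambda>_. nerve_point i)"
    unfolding induced_hom_def \<phi>_def[symmetric] by (simp add: iU)
qed

lemma cech_hom_not_inj: "\<not> inj_on (cech_hom P b0) (carrier (fundamental_group P b0))"
proof
  assume inj: "inj_on (cech_hom P b0) (carrier (fundamental_group P b0))"
  let ?p = "pants_loop 1" and ?c = "\<lambda>_::real. b0"
  have p: "loop_in P b0 ?p" by (rule loop_in_pants_loop) simp
  have c: "loop_in P b0 ?c" using basepoint_in by (simp add: loop_in_def pathin_def)
  \<comment> \<open>Both the first loop and the constant loop are sent to the family of trivial
    classes.\<close>
  have "cech_hom P b0 (loop_class P b0 ?p) = cech_hom P b0 (loop_class P b0 ?c)"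
  proof (subst cech_hom_null[OF p])
    show "loop_homotopic (realization (nerve \<U>)) (vertex_point U0) (nerve_map \<U> \<phi> \<circ> ?p) (\<lambda>_. vertex_point U0)"
      if "(\<U>, U0) \<in> pointed_covers P b0" "pointed_partition_of_unity P b0 \<U> U0 \<phi>" for \<U> U0 \<phi>
      using that by (rule pants_loop_null_in_nerve) simp
  next
    have "loop_homotopic (realization (nerve \<U>)) (vertex_point U0) (nerve_map \<U> \<phi> \<circ> ?c) (\<lambda>_. vertex_point U0)"
      if "(\<U>, U0) \<in> pointed_covers P b0" and pou: "pointed_partition_of_unity P b0 \<U> U0 \<phi>" for \<U> U0 \<phi>
    proof -
      have U0: "U0 \<in> \<U>" using that by (simp add: pointed_covers_def)
      show ?thesis
        using loop_homotopic_compose[OF loop_homotopic_refl[OF c] continuous_map_nerve_map[OF pou U0]]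
        by (simp add: nerve_map_basepoint[OF pou U0 basepoint_in] o_def)
    qed
    then show "(\<lambda>i\<in>pointed_covers P b0. loop_class (nerve_space i) (nerve_point i) (\<lambda>_. nerve_point i)) =
        cech_hom P b0 (loop_class P b0 ?c)"
      using cech_hom_null[OF c] by simp
  qed
  then have "loop_class P b0 ?p = loop_class P b0 ?c"
    by (rule inj_onD[OF inj]) (use p c in \<open>auto simp: fundamental_group_def\<close>)
  moreover have "?c \<in> loop_class P b0 ?c" using loop_homotopic_refl[OF c] by (simp add: loop_class_def)
  ultimately have "loop_homotopic P b0 ?p ?c" by (simp add: loop_class_def set_eq_iff)
  then show False using pants_loop_1_not_null by simp
qed

end

theorem theorem3p6:
  fixes D D1 D2 :: "nat \<Rightarrow> complex set"
    and \<alpha> \<beta> \<gamma> :: "nat \<Rightarrow> real \<Rightarrow> complex"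
    and f :: "nat \<Rightarrow> complex \<Rightarrow> complex"
  assumes disks: "\<And>n. n \<ge> 1 \<Longrightarrow> closed_disk (D n) \<and> closed_disk (D1 n) \<and> closed_disk (D2 n)"
    and inside: "\<And>n. n \<ge> 1 \<Longrightarrow> D1 n \<subseteq> interior (D n) \<and> D2 n \<subseteq> interior (D n)"
    and disjoint: "\<And>n. n \<ge> 1 \<Longrightarrow> D1 n \<inter> D2 n = {}"
    and alpha: "\<And>n. n \<ge> 1 \<Longrightarrow> clockwise_boundary (D n) (\<alpha> n)"
    and beta: "\<And>n. n \<ge> 1 \<Longrightarrow> clockwise_boundary (D1 n) (\<beta> n)"
    and gamma: "\<And>n. n \<ge> 1 \<Longrightarrow> clockwise_boundary (D2 n) (\<gamma> n)"
    and f_alpha: "\<And>n t. n \<ge> 1 \<Longrightarrow> t \<in> {0..1} \<Longrightarrow> f n (\<alpha> n t) = earring_loop n t"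
    and f_beta: "\<And>n t. n \<ge> 1 \<Longrightarrow> t \<in> {0..1} \<Longrightarrow> f n (\<beta> n t) = earring_loop (2 * n) t"
    and f_gamma: "\<And>n t. n \<ge> 1 \<Longrightarrow> t \<in> {0..1} \<Longrightarrow> f n (\<gamma> n t) = earring_loop (2 * n + 1) t"
  shows "\<not> inj_on (cech_hom (hawaiian_pants D D1 D2 f) (pants_basepoint D D1 D2 f))
           (carrier (fundamental_group (hawaiian_pants D D1 D2 f) (pants_basepoint D D1 D2 f)))"
proof -
  interpret hawaiian_pants_data D D1 D2 \<alpha> \<beta> \<gamma> f
    by unfold_locales (rule assms; assumption)+
  show ?thesis by (rule cech_hom_not_inj)
qed

end
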